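(* Let $\sigma_t,\tau_t,\delta_t$, the signs $\epsilon_i$, and the sets $X_{\tau_t}^{(i)},X_{\tau_t}'^{(i)},X_{\sigma_t}^{(i^{\epsilon_i})},X_{\sigma_t}'^{(i^{\epsilon_i})},X_{\sigma_t},X'_{\sigma_t}$ be as defined in the context. For $t=1,2,4$ and $i\in\{1,2\}$ the following equations hold: $$X_{\sigma_t}^{(i^{\epsilon_i})}=\bigcup_{j\in\{1,2\}}\ \bigcup_{k:\,w^{(j)}_k=i^{\epsilon_i}}\big(-\pi_{\sigma_t}f(P^{(j)}_k)+A_{\delta_t}^{-1}X_{\tau_t}^{(j)}\big),$$ $$X_{\sigma_t}'^{(i^{\epsilon_i})}=\bigcup_{j\in\{1,2\}}\ \bigcup_{k:\,w^{(j)}_k=i^{\epsilon_i}}\big(\pi_{\sigma_t}f(S^{(j)}_k)+A_{\delta_t}^{-1}X_{\tau_t}'^{(j)}\big),$$ where $\delta_t^{-1}(j)=w^{(j)}_1\cdots w^{(j)}_k\cdots w^{(j)}_{l^{(j)}}=P^{(j)}_kw^{(j)}_kS^{(j)}_k$, i.e. $P_k^{(j)}=w_1^{(j)}\cdots w_{k-1}^{(j)}$ and $S_k^{(j)}=w_{k+1}^{(j)}\cdots w^{(j)}_{l^{(j)}}$. The unions are disjoint in the sense of Lebesgue measure. Moreover, $X_{\sigma_t}^{(i^{\epsilon_i})}$, $X_{\sigma_t}'^{(i^{\epsilon_i})}$, $X_{\sigma_t}$ and $X'_{\sigma_t}$ are intervals.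
   Context: Let $F_2$ be the free group on the letters $1,2$, and let $f:F_2\to\mathbb Z^2$ be the homomorphism with $f(i^{\pm1})=\pm e_i$ ($e_1,e_2$ the standard basis; $f$ of the empty word is $0$). For an endomorphism $\sigma$ of $F_2$, $A_\sigma$ is the $2\times2$ matrix with columns $f(\sigma(1)),f(\sigma(2))$. The automorphisms ($2^{k}$ with $k<0$ means $(2^{-1})^{|k|}$; $a$ is an integer): - $t=1$, $a\ge3$: $\sigma_1:1\mapsto2,\ 2\mapsto2^{a-2}1^{-1}22$; $\tau_1:1\mapsto2^{a-3}12,\ 2\mapsto2^{a-2}12$; $\delta_1:1\mapsto21^{-1},\ 2\mapsto2$; $\delta_1^{-1}:1\mapsto1^{-1}2,\ 2\mapsto2$. - $t=2$, $a\le-3$: $\sigma_2:1\mapsto2,\ 2\mapsto1^{-1}2^{a}$; $\tau_2:1\mapsto1^{-1}2^{a+2},\ 2\mapsto1^{-1}2^{a+1}$; $\delta_2:1\mapsto2^{-1}1,\ 2\mapsto2$; $\delta_2^{-1}:1\mapsto21,\ 2\mapsto2$. - $t=4$, $a\le-1$: $\sigma_4:1\mapsto2,\ 2\mapsto12^{a}$; $\tau_4:1\mapsto2^{-1},\ 2\mapsto1^{-1}2^{a}$; $\delta_4=\delta_4^{-1}:1\mapsto1^{-1},\ 2\mapsto2$. In each case $\sigma_t=\delta_t^{-1}\circ\tau_t\circ\delta_t$. The matrices $A_{\sigma_t}$ and $A_{\tau_t}$ have the same eigenvalues $\lambda_t,\lambda_t'$ with $|\lambda_t|>1>|\lambda_t'|$.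 Signs: $\epsilon_1=-1$ for $t=1,4$, $\epsilon_1=1$ for $t=2$, and $\epsilon_2=1$ always. $\mathcal G^*$ is the free $\mathbb Z$-module with basis the symbols $(x,i^* )$, $x\in\mathbb Z^2$, $i\in\{1,2\}$. The symbol $(x,1^* )$ is identified with the unit segment $\{x+se_2:0\le s\le1\}$ and $(x,2^* )$ with $\{x+se_1:0\le s\le1\}$; an element of $\mathcal G^*$ is identified, as a subset of $\mathbb R^2$, with the union of the segments occurring with nonzero coefficient. For an endomorphism $\sigma$ of $F_2$ with $\det A_\sigma=\pm1$ and $\sigma(j)=w^{(j)}_1\cdots w^{(j)}_{l^{(j)}}$ (reduced word), put $S^{(j)}_k=w^{(j)}_{k+1}\cdots w^{(j)}_{l^{(j)}}$. The tiling substitution $\sigma^*:\mathcal G^*\to\mathcal G^*$ is the $\mathbb Z$-linear map $$\sigma^*(x,i^* )=\sum_{j\in\{1,2\}}\Big\{\sum_{k:\,w^{(j)}_k=i}\big(A_\sigma^{-1}(x+f(S^{(j)}_k)),j^*\big)-\sum_{k:\,w^{(j)}_k=i^{-1}}\big(A_\sigma^{-1}(x+f(w^{(j)}_kS^{(j)}_k)),j^*\big)\Big\},$$ and $\sigma^{*\,n}$ is its $n$-th iterate. For $\rho\in\{\sigma_t,\tau_t\}$, $P_\rho\subset\mathbb R^2$ is the eigenline of $A_\rho$ for $\lambda_t'$, and $\pi_\rho:\mathbb R^2\to P_\rho$ is the projection along the eigenline of $A_\rho$ for $\lambda_t$. For $y\in P_\rho$ and $S\subset P_\rho$, $y+S=\{y+s:s\in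 S\}$. "Interval" means a line segment in $P_\rho$; Lebesgue measure is one-dimensional Lebesgue measure on the line $P_\rho$. Rauzy fractals (limits of compact sets in the Hausdorff metric; these limits exist). For $\tau=\tau_t$: $X_\tau^{(i)}=\lim_n A_\tau^n\pi_\tau\tau^{*\,n}(e_i,i^* )$ and $X_\tau'^{(i)}=\lim_n A_\tau^n\pi_\tau\tau^{*\,n}(0,i^* )$, $i\in\{1,2\}$. For $\sigma=\sigma_t$: $X_\sigma=\lim_n A_\sigma^n\pi_\sigma\sigma^{*\,n}(\overline{\mathcal U})$ and $X'_\sigma=\lim_n A_\sigma^n\pi_\sigma\sigma^{*\,n}(\overline{\mathcal U}')$, where $\overline{\mathcal U}=(e_1,1^* )+(e_2,2^* )$, $\overline{\mathcal U}'=(0,1^* )+(0,2^* )$ if $t=2$, and $\overline{\mathcal U}=(0,1^* )+(e_2,2^* )$, $\overline{\mathcal U}'=(e_1,1^* )+(0,2^* )$ if $t=1,4$. For $t=2$: $X_{\sigma}^{(i)}=\lim_n A_{\sigma}^n\pi_{\sigma}\sigma^{*\,n}(e_i,i^* )$, $X_{\sigma}'^{(i)}=\lim_n A_{\sigma}^n\pi_{\sigma}\sigma^{*\,n}(0,i^* )$. For $t=1,4$: $X_{\sigma}^{(1^{-1})}=\lim_n A_{\sigma}^n\pi_{\sigma}\sigma^{*\,n}(0,1^* )$, $X_{\sigma}^{(2)}=\lim_n A_{\sigma}^n\pi_{\sigma}\sigma^{*\,n}(e_2,2^* )$, $X_{\sigma}'^{(1^{-1})}=\lim_n A_{\sigma}^n\pi_{\sigma}\sigma^{*\,n}(e_1,1^*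 )$, $X_{\sigma}'^{(2)}=\lim_n A_{\sigma}^n\pi_{\sigma}\sigma^{*\,n}(0,2^* )$. *)

theory Defs
  imports "HOL-Analysis.Analysis" "HOL-Library.Poly_Mapping"
begin

section \<open>Words over the letters of the free group, and endomorphisms\<close>

text \<open>
  The index set of the generators and of the coordinates of the plane is the two-element type
  \<open>2\<close>, with \<open>UNIV = {1, 2}\<close>. \<open>Gen i\<close> is the generator \<open>i\<close> and \<open>Inv i\<close> its inverse. Elements of the
  free group are represented by reduced words. Note that the numeral \<open>2 :: 2\<close> equals \<open>0\<close>; only \<open>1 \<noteq> 2\<close> matters.
\<close>

datatype letter = Gen "2" | Inv "2"

type_synonym word = "letter list"

fun reduced :: "word \<Rightarrow> bool" where
  "reduced (Gen i # Inv j # w) \<longleftrightarrow> i \<noteq> j \<and> reduced (Inv j # w)"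
| "reduced (Inv i # Gen j # w) \<longleftrightarrow> i \<noteq> j \<and> reduced (Gen j # w)"
| "reduced (_ # y # w) \<longleftrightarrow> reduced (y # w)"
| "reduced _ \<longleftrightarrow> True"

definition gen_pow :: "2 \<Rightarrow> int \<Rightarrow> word" where
  "gen_pow i k = (if k \<ge> 0 then replicate (nat k) (Gen i) else replicate (nat (- k)) (Inv i))"

text \<open>An endomorphism of the free group is given by the reduced words that are the images of the
  two generators.\<close>

type_synonym endo = "2 \<Rightarrow> word"

definition endo :: "word \<Rightarrow> word \<Rightarrow> endo" where
  "endo u v = (\<lambda>j. if j = 1 then u else v)"

fun letter_vec :: "letter \<Rightarrow> int ^ 2" where
  "letter_vec (Gen i) = axis i 1"
| "letter_vec (Inv i) = - axis i 1"

definition abel :: "word \<Rightarrow> int ^ 2" where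
  "abel w = sum_list (map letter_vec w)"

definition inc_mat :: "endo \<Rightarrow> int ^ 2 ^ 2" where
  "inc_mat \<sigma> = (\<chi> i j. abel (\<sigma> j) $ i)"

definition real_vec :: "int ^ 2 \<Rightarrow> real ^ 2" where
  "real_vec x = (\<chi> i. real_of_int (x $ i))"

definition real_mat :: "endo \<Rightarrow> real ^ 2 ^ 2" where
  "real_mat \<sigma> = (\<chi> i j. real_of_int (inc_mat \<sigma> $ i $ j))"

section \<open>The three families of automorphisms\<close>

datatype family = T1 | T2 | T4

fun admissible :: "family \<Rightarrow> int \<Rightarrow> bool" where
  "admissible T1 a \<longleftrightarrow> a \<ge> 3"
| "admissible T2 a \<longleftrightarrow> a \<le> -3"
| "admissible T4 a \<longleftrightarrow> a \<le> -1"

fun sigma_aut :: "family \<Rightarrow> int \<Rightarrow> endo" where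
  "sigma_aut T1 a = endo [Gen 2] (gen_pow 2 (a - 2) @ [Inv 1, Gen 2, Gen 2])"
| "sigma_aut T2 a = endo [Gen 2] (Inv 1 # gen_pow 2 a)"
| "sigma_aut T4 a = endo [Gen 2] (Gen 1 # gen_pow 2 a)"

fun tau_aut :: "family \<Rightarrow> int \<Rightarrow> endo" where
  "tau_aut T1 a = endo (gen_pow 2 (a - 3) @ [Gen 1, Gen 2]) (gen_pow 2 (a - 2) @ [Gen 1, Gen 2])"
| "tau_aut T2 a = endo (Inv 1 # gen_pow 2 (a + 2)) (Inv 1 # gen_pow 2 (a + 1))"
| "tau_aut T4 a = endo [Inv 2] (Inv 1 # gen_pow 2 a)"

fun delta_aut :: "family \<Rightarrow> endo" where
  "delta_aut T1 = endo [Gen 2, Inv 1] [Gen 2]"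
| "delta_aut T2 = endo [Inv 2, Gen 1] [Gen 2]"
| "delta_aut T4 = endo [Inv 1] [Gen 2]"

fun delta_aut_inv :: "family \<Rightarrow> endo" where
  "delta_aut_inv T1 = endo [Inv 1, Gen 2] [Gen 2]"
| "delta_aut_inv T2 = endo [Gen 2, Gen 1] [Gen 2]"
| "delta_aut_inv T4 = endo [Inv 1] [Gen 2]"

text \<open>The letter $i^{\epsilon_i}$.\<close>

definition eps_letter :: "family \<Rightarrow> 2 \<Rightarrow> letter" where
  "eps_letter t i = (if t \<noteq> T2 \<and> i = 1 then Inv i else Gen i)"

lemma reduced_Inv_gen_pow: "k < 0 \<Longrightarrow> reduced (Inv i # gen_pow 2 k)"
proof -
  have "reduced (Inv i # replicate m (Inv j))" for m j
    by (induction m arbitrary: i) auto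
  then show "k < 0 \<Longrightarrow> reduced (Inv i # gen_pow 2 k)"
    by (simp add: gen_pow_def)
qed

lemma reduced_Gen_gen_pow: "k < 0 \<Longrightarrow> reduced (Gen 1 # gen_pow 2 k)"
proof -
  have "reduced (Inv j # replicate m (Inv j))" for m and j :: 2
    by (induction m) auto
  then have "reduced (Gen 1 # replicate m (Inv 2))" for m
    by (cases m) auto
  then show "k < 0 \<Longrightarrow> reduced (Gen 1 # gen_pow 2 k)"
    by (simp add: gen_pow_def)
qed

lemma reduced_gen_pow_append:
  assumes "k \<ge> 0" "reduced (Gen 2 # w)" "reduced w"
  shows "reduced (gen_pow 2 k @ w)"
proof -
  have "reduced (replicate m (Gen 2) @ w)
      \<and> reduced (Gen 2 # replicate m (Gen 2) @ w)" for m
    by (induction m) (use assms in auto)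
  then show ?thesis
    using assms(1) by (simp add: gen_pow_def)
qed

lemma reduced_families:
  assumes "admissible t a"
  shows "reduced (sigma_aut t a j)" "reduced (tau_aut t a j)" "reduced (delta_aut t j)"
    "reduced (delta_aut_inv t j)"
  using assms
  by (cases t; auto simp: endo_def intro!: reduced_Inv_gen_pow reduced_Gen_gen_pow
        reduced_gen_pow_append)+

section \<open>The tiling substitution\<close>

text \<open>\<open>(x, i)\<close> stands for the basis symbol $(x, i^*)$; the module is the free $\mathbb{Z}$-module on
  these symbols.\<close>

type_synonym symb = "(int ^ 2) \<times> 2"

type_synonym chain = "symb \<Rightarrow>\<^sub>0 int"

text \<open>Positions are counted from 0, so with \<open>w = \<sigma> j\<close> the words $P_k$, $S_k$ and $w_k S_k$ are
  \<open>take k w\<close>, \<open>drop (Suc k) w\<close> and \<open>drop k w\<close>. The matrix inverse in \<open>tile_subst\<close> is taken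
  over the integers.\<close>

definition occ :: "word \<Rightarrow> letter \<Rightarrow> nat set" where
  "occ w l = {k. k < length w \<and> w ! k = l}"

definition tile_subst :: "endo \<Rightarrow> chain \<Rightarrow> chain" where
  "tile_subst \<sigma> = frag_extend (\<lambda>(x, i). \<Sum>j\<in>UNIV.
      (\<Sum>k\<in>occ (\<sigma> j) (Gen i).
         frag_of (matrix_inv (inc_mat \<sigma>) *v (x + abel (drop (Suc k) (\<sigma> j))), j))
    - (\<Sum>k\<in>occ (\<sigma> j) (Inv i).
         frag_of (matrix_inv (inc_mat \<sigma>) *v (x + abel (drop k (\<sigma> j))), j)))"

text \<open>The segment of \<open>(x, i)\<close> points in the direction of the \<^emph>\<open>other\<close> coordinate axis.\<close>

definition segment :: "symb \<Rightarrow> (real ^ 2) set" where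
  "segment = (\<lambda>(x, i).
     closed_segment (real_vec x) (real_vec x + axis (if i = 1 then 2 else 1) 1))"

definition realization :: "chain \<Rightarrow> (real ^ 2) set" where
  "realization g = (\<Union>s\<in>Poly_Mapping.keys g. segment s)"

section \<open>Eigenlines and projections\<close>

definition is_eigenvalue :: "real ^ 2 ^ 2 \<Rightarrow> real \<Rightarrow> bool" where
  "is_eigenvalue A c \<longleftrightarrow> (\<exists>v. v \<noteq> 0 \<and> A *v v = c *\<^sub>R v)"

definition expanding_eigenvalue :: "real ^ 2 ^ 2 \<Rightarrow> real" where
  "expanding_eigenvalue A = (THE c. is_eigenvalue A c \<and> \<bar>c\<bar> > 1)"

definition contracting_eigenvalue :: "real ^ 2 ^ 2 \<Rightarrow> real" where
  "contracting_eigenvalue A = (THE c. is_eigenvalue A c \<and> \<bar>c\<bar> < 1)"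

definition eigenspace :: "real ^ 2 ^ 2 \<Rightarrow> real \<Rightarrow> (real ^ 2) set" where
  "eigenspace A c = {v. A *v v = c *\<^sub>R v}"

definition contracting_line :: "endo \<Rightarrow> (real ^ 2) set" where
  "contracting_line \<sigma> = eigenspace (real_mat \<sigma>) (contracting_eigenvalue (real_mat \<sigma>))"

definition expanding_line :: "endo \<Rightarrow> (real ^ 2) set" where
  "expanding_line \<sigma> = eigenspace (real_mat \<sigma>) (expanding_eigenvalue (real_mat \<sigma>))"

definition proj :: "endo \<Rightarrow> real ^ 2 \<Rightarrow> real ^ 2" where
  "proj \<sigma> v = (THE p. p \<in> contracting_line \<sigma> \<and> v - p \<in> expanding_line \<sigma>)"

definition is_interval_in :: "(real ^ 2) set \<Rightarrow> (real ^ 2) set \<Rightarrow> bool" where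
  "is_interval_in P S \<longleftrightarrow> (\<exists>p\<in>P. \<exists>q\<in>P. p \<noteq> q \<and> S = closed_segment p q)"

text \<open>\<open>S\<close> is a null set for one-dimensional Lebesgue measure on the line \<open>P\<close> through the origin.\<close>

definition line_null :: "(real ^ 2) set \<Rightarrow> (real ^ 2) set \<Rightarrow> bool" where
  "line_null P S \<longleftrightarrow>
     (\<exists>u. norm u = 1 \<and> P = span {u} \<and> {s :: real. s *\<^sub>R u \<in> S} \<in> null_sets lebesgue)"

section \<open>Rauzy fractals\<close>

definition hausdorff_dist :: "'a::metric_space set \<Rightarrow> 'a set \<Rightarrow> real" where
  "hausdorff_dist A B = max (SUP x\<in>A. infdist x B) (SUP y\<in>B. infdist y A)"

definition hausdorff_lim :: "(nat \<Rightarrow> 'a::metric_space set) \<Rightarrow> 'a set" where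
  "hausdorff_lim K =
     (THE L. compact L \<and> L \<noteq> {} \<and> (\<lambda>n. hausdorff_dist (K n) L) \<longlonglongrightarrow> 0)"

definition rauzy :: "endo \<Rightarrow> chain \<Rightarrow> (real ^ 2) set" where
  "rauzy \<rho> g = hausdorff_lim (\<lambda>n.
     ((\<lambda>v. real_mat \<rho> *v v) ^^ n) ` proj \<rho> ` realization ((tile_subst \<rho> ^^ n) g))"

text \<open>\<open>seed\<close> and \<open>seed'\<close> give, for a letter $i$ or $i^{-1}$, the starting symbols of the unprimed and
  of the primed fractals: $(e_i, i^*)$ and $(0, i^*)$ for $i$, and the other way round for
  $i^{-1}$.\<close>

fun seed :: "letter \<Rightarrow> chain" where
  "seed (Gen i) = frag_of (axis i 1, i)"
| "seed (Inv i) = frag_of (0, i)"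

fun seed' :: "letter \<Rightarrow> chain" where
  "seed' (Gen i) = frag_of (0, i)"
| "seed' (Inv i) = frag_of (axis i 1, i)"

definition X_tau :: "family \<Rightarrow> int \<Rightarrow> 2 \<Rightarrow> (real ^ 2) set" where
  "X_tau t a i = rauzy (tau_aut t a) (seed (Gen i))"

definition X_tau' :: "family \<Rightarrow> int \<Rightarrow> 2 \<Rightarrow> (real ^ 2) set" where
  "X_tau' t a i = rauzy (tau_aut t a) (seed' (Gen i))"

text \<open>\<open>X_sigma_part t a i\<close> is $X_{\sigma_t}^{(i^{\epsilon_i})}$, and \<open>X_sigma t a\<close> is
  $X_{\sigma_t}$.\<close>

definition X_sigma_part :: "family \<Rightarrow> int \<Rightarrow> 2 \<Rightarrow> (real ^ 2) set" where
  "X_sigma_part t a i = rauzy (sigma_aut t a) (seed (eps_letter t i))"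

definition X_sigma_part' :: "family \<Rightarrow> int \<Rightarrow> 2 \<Rightarrow> (real ^ 2) set" where
  "X_sigma_part' t a i = rauzy (sigma_aut t a) (seed' (eps_letter t i))"

definition X_sigma :: "family \<Rightarrow> int \<Rightarrow> (real ^ 2) set" where
  "X_sigma t a = rauzy (sigma_aut t a) (seed (eps_letter t 1) + seed (eps_letter t 2))"

definition X_sigma' :: "family \<Rightarrow> int \<Rightarrow> (real ^ 2) set" where
  "X_sigma' t a = rauzy (sigma_aut t a) (seed' (eps_letter t 1) + seed' (eps_letter t 2))"

text \<open>The translated copies $-\pi_{\sigma_t} f(P_k^{(j)}) + A_{\delta_t}^{-1} X_{\tau_t}^{(j)}$ and
  $\pi_{\sigma_t} f(S_k^{(j)}) + A_{\delta_t}^{-1} X_{\tau_t}'^{(j)}$.\<close>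

definition piece :: "family \<Rightarrow> int \<Rightarrow> 2 \<Rightarrow> nat \<Rightarrow> (real ^ 2) set" where
  "piece t a j k =
     (\<lambda>v. - proj (sigma_aut t a) (real_vec (abel (take k (delta_aut_inv t j))))
          + matrix_inv (real_mat (delta_aut t)) *v v) ` X_tau t a j"

definition piece' :: "family \<Rightarrow> int \<Rightarrow> 2 \<Rightarrow> nat \<Rightarrow> (real ^ 2) set" where
  "piece' t a j k =
     (\<lambda>v. proj (sigma_aut t a) (real_vec (abel (drop (Suc k) (delta_aut_inv t j))))
          + matrix_inv (real_mat (delta_aut t)) *v v) ` X_tau' t a j"

end

theory Submission
  imports Defs
begin

text \<open>
  Let \<open>\<kappa>'\<close> be the contracting eigenvalue. A left eigenvector for \<open>\<kappa>'\<close> is a linear coordinate on the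
  contracting line that vanishes on the expanding line, and in this coordinate the rescaled projections
  of the iterates of a tile are subsets of \<open>\<real>\<close>. Each of the tiling substitutions maps a chain that is a
  lattice path from \<open>p\<close> to \<open>q\<close> to one from \<open>T p\<close> to \<open>T q\<close>, where \<open>T x = A\<^sup>-\<^sup>1 (x + c)\<close> with a constant \<open>c\<close>.
  Hence the rescaled projection of the \<open>n\<close>-th iterate covers an interval whose ends converge to the
  coordinates of \<open>p\<close> and \<open>q\<close> plus the same offset \<open>\<ell>(c) / (1 - \<kappa>')\<close>; conversely the tiles stay within
  distance \<open>O(\<bar>\<kappa>'\<bar>\<^sup>n)\<close> of that interval. So every fractal in question is a translate of the projection of
  its starting path, by an offset that depends only on the substitution, and the set equations reduce to
  equations between end points of intervals. The boundary is used modulo 2 only, because the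
  starting chains of the full fractals carry signs that do not match their orientation as paths.
\<close>

section \<open>Hausdorff limits\<close>

lemma hausdorff_dist_bound:
  assumes "A \<noteq> {}" "B \<noteq> {}"
    and AB: "\<And>x. x \<in> A \<Longrightarrow> \<exists>y\<in>B. dist x y \<le> e"
    and BA: "\<And>y. y \<in> B \<Longrightarrow> \<exists>x\<in>A. dist x y \<le> e"
  shows "\<bar>hausdorff_dist A B\<bar> \<le> e"
proof -
  have *: "0 \<le> (SUP x\<in>S. infdist x T) \<and> (SUP x\<in>S. infdist x T) \<le> e"
    if ST: "S \<noteq> {}" "\<And>x. x \<in> S \<Longrightarrow> \<exists>y\<in>T. dist x y \<le> e" for S T :: "'a set"
  proof
    have le: "infdist x T \<le> e" if "x \<in> S" for x
      using ST(2)[OF that] infdist_le2 by blast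
    show "(SUP x\<in>S. infdist x T) \<le> e"
      using ST(1) le by (rule cSUP_least)
    obtain x where x: "x \<in> S" using ST(1) by blast
    show "0 \<le> (SUP x\<in>S. infdist x T)"
      by (rule cSUP_upper2[where x = x]) (use x le in \<open>auto intro!: bdd_aboveI2 infdist_nonneg\<close>)
  qed
  show ?thesis
    using *[of A B] *[of B A] assms by (auto simp: hausdorff_dist_def dist_commute)
qed

text \<open>Boundedness of \<open>A\<close> makes the supremum over \<open>A\<close> a genuine upper
  bound; over an unbounded family a real supremum is an unspecified value.\<close>

lemma infdist_le_hausdorff_dist:
  assumes "bounded A" "B \<noteq> {}"
  shows "x \<in> A \<Longrightarrow> infdist x B \<le> hausdorff_dist A B"
    and "x \<in> A \<Longrightarrow> infdist x B \<le> hausdorff_dist B A"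
proof -
  obtain b where b: "b \<in> B" using assms(2) by blast
  obtain r where "\<forall>x\<in>A. dist b x \<le> r"
    using assms(1) bounded_any_center[of A b] by auto
  then have "infdist y B \<le> r" if "y \<in> A" for y
    using infdist_le2[OF b, of y r] that by (auto simp: dist_commute)
  then have "bdd_above ((\<lambda>x. infdist x B) ` A)"
    by (rule bdd_aboveI2)
  then have "infdist x B \<le> (SUP x\<in>A. infdist x B)" if "x \<in> A"
    using that by (rule cSUP_upper2) auto
  then show "x \<in> A \<Longrightarrow> infdist x B \<le> hausdorff_dist A B" "x \<in> A \<Longrightarrow> infdist x B \<le> hausdorff_dist B A"
    by (simp_all add: hausdorff_dist_def le_max_iff_disj)
qed

text \<open>Replacing \<open>B\<close> by a set that comes within \<open>e\<close> of each of its
  points costs at most \<open>e\<close>. The uniqueness argument for limits passes from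
  \<open>K n\<close> to \<open>L\<close> in this way.\<close>

lemma infdist_le_infdist_add:
  assumes "B \<noteq> {}" "\<And>y. y \<in> B \<Longrightarrow> \<exists>z\<in>C. dist y z \<le> e"
  shows "infdist x C \<le> infdist x B + e"
proof -
  have "infdist x C - e \<le> dist x y" if y: "y \<in> B" for y
  proof -
    obtain z where z: "z \<in> C" "dist y z \<le> e" using assms(2)[OF y] by blast
    have "infdist x C \<le> dist x z" by (rule infdist_le[OF z(1)])
    then show ?thesis using dist_triangle[of x z y] z(2) by linarith
  qed
  then have "infdist x C - e \<le> infdist x B"
    unfolding infdist_notempty[OF assms(1)] by (intro cINF_greatest assms(1))
  then show ?thesis by simp
qed

text \<open>\<open>hausdorff_lim\<close> is a definite description, so uniqueness is part of the
  claim: points of a competing limit \<open>M\<close> have distance 0 from \<open>L\<close> and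
  conversely, and both sets are closed. The \<open>K n\<close> are bounded because they stay within
  \<open>e n\<close> of the compact set \<open>L\<close>.\<close>

lemma hausdorff_lim_eqI:
  fixes K :: "nat \<Rightarrow> 'a::metric_space set"
  assumes L: "compact L" "L \<noteq> {}" and e: "e \<longlonglongrightarrow> 0"
    and KL: "\<And>n x. x \<in> K n \<Longrightarrow> \<exists>y\<in>L. dist x y \<le> e n"
    and LK: "\<And>n y. y \<in> L \<Longrightarrow> \<exists>x\<in>K n. dist x y \<le> e n"
  shows "hausdorff_lim K = L"
proof -
  have ne: "K n \<noteq> {}" for n using LK L(2) by blast
  have bK: "bounded (K n)" for n
  proof -
    obtain l r where "\<forall>y\<in>L. dist l y \<le> r"
      using compact_imp_bounded[OF L(1)] unfolding bounded_def by blast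
    then have "dist l x \<le> r + e n" if "x \<in> K n" for x
      using KL[OF that] dist_triangle[of l x] by (smt (verit) dist_commute)
    then show ?thesis unfolding bounded_def by blast
  qed
  have lim0: "(\<lambda>n. hausdorff_dist (K n) L) \<longlonglongrightarrow> 0"
  proof (rule Lim_null_comparison[OF _ e], rule always_eventually, rule allI)
    fix n show "norm (hausdorff_dist (K n) L) \<le> e n"
      using hausdorff_dist_bound[OF ne L(2) KL LK] by simp
  qed
  have uniq: "M = L" if M: "compact M" "M \<noteq> {}" "(\<lambda>n. hausdorff_dist (K n) M) \<longlonglongrightarrow> 0" for M
  proof
    have lim: "(\<lambda>n. hausdorff_dist (K n) M + e n) \<longlonglongrightarrow> 0"
      using tendsto_add[OF M(3) e] by simp
    show "M \<subseteq> L"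
    proof
      fix x assume x: "x \<in> M"
      have "infdist x L \<le> hausdorff_dist (K n) M + e n" for n
        using infdist_le_hausdorff_dist(2)[OF compact_imp_bounded[OF M(1)] ne[of n] x]
          infdist_le_infdist_add[of "K n" L "e n" x, OF ne KL] by linarith
      then have "infdist x L \<le> 0"
        by (intro LIMSEQ_le_const[OF lim]) auto
      then show "x \<in> L"
        using L in_closed_iff_infdist_zero[of L x] infdist_nonneg[of x L]
        by (simp add: compact_imp_closed)
    qed
    show "L \<subseteq> M"
    proof
      fix x assume x: "x \<in> L"
      have "infdist x M \<le> hausdorff_dist (K n) M + e n" for n
      proof -
        obtain y where y: "y \<in> K n" "dist y x \<le> e n" using LK[OF x] by blast
        have "infdist x M \<le> infdist y M + dist x y"
          by (rule infdist_triangle)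
        then show ?thesis
          using infdist_le_hausdorff_dist(1)[OF bK M(2) y(1)] y(2) by (simp add: dist_commute)
      qed
      then have "infdist x M \<le> 0"
        by (intro LIMSEQ_le_const[OF lim]) auto
      then show "x \<in> M"
        using M in_closed_iff_infdist_zero[of M x] infdist_nonneg[of x M]
        by (simp add: compact_imp_closed)
    qed
  qed
  show ?thesis
    unfolding hausdorff_lim_def
  proof (rule the_equality)
    show "compact L \<and> L \<noteq> {} \<and> (\<lambda>n. hausdorff_dist (K n) L) \<longlonglongrightarrow> 0"
      using L lim0 by blast
  qed (use uniq in blast)
qed

section \<open>Boundaries modulo 2\<close>

text \<open>The segment of the symbol \<open>(x, i)\<close> runs from \<open>x\<close> in direction
  \<open>other i\<close>.\<close>

definition other :: "2 \<Rightarrow> 2" where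
  "other i = (if i = 1 then 2 else 1)"

text \<open>The sum of the values of \<open>h\<close> at the two ends of the segments of \<open>g\<close>. Its parity is that of
  the pairing of \<open>h\<close> with the boundary of \<open>g\<close>, and is insensitive to the signs in \<open>g\<close>.\<close>

definition bd :: "(int ^ 2 \<Rightarrow> int) \<Rightarrow> chain \<Rightarrow> int" where
  "bd h g = (\<Sum>s\<in>Poly_Mapping.keys g. Poly_Mapping.lookup g s *
      (h (fst s) + h (fst s + axis (other (snd s)) 1)))"

text \<open>Reads \<open>bd h\<close> as the only coefficient of a homomorphism into the free module
  on the one generator \<open>()\<close>, so that its linearity comes from
  \<open>frag_extend\<close>.\<close>

lemma bd_conv_frag_extend:
  "bd h g = Poly_Mapping.lookup (frag_extend
     (\<lambda>s. frag_cmul (h (fst s) + h (fst s + axis (other (snd s)) 1)) (frag_of ())) g) ()"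
  by (simp add: bd_def frag_extend_def lookup_sum)

lemma bd_0 [simp]: "bd h 0 = 0"
  and bd_add: "bd h (g + g') = bd h g + bd h g'"
  and bd_diff: "bd h (g - g') = bd h g - bd h g'"
  and bd_cmul: "bd h (frag_cmul k g) = k * bd h g"
  by (simp_all add: bd_conv_frag_extend frag_extend_add frag_extend_diff frag_extend_cmul
      lookup_add lookup_minus)

lemma bd_of: "bd h (frag_of (x, i)) = h x + h (x + axis (other i) 1)"
  by (simp add: bd_def)

lemma bd_sum_list: "bd h (sum_list gs) = sum_list (map (bd h) gs)"
  by (induction gs) (auto simp: bd_add)

text \<open>Both terms are additive in \<open>g\<close>, so parities need only be compared on single
  symbols. In the application \<open>h'\<close> is the pullback of \<open>h\<close> along a map of
  base points.\<close>

lemma even_bd_frag_extend: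
  assumes "\<And>x i. even (bd h (f (x, i)) - bd h' (frag_of (x, i)))"
  shows "even (bd h (frag_extend f g) - bd h' g)"
  using subset_UNIV
proof (induction g rule: frag_induction)
  case (diff a b)
  then have "even ((bd h (frag_extend f a) - bd h' a) - (bd h (frag_extend f b) - bd h' b))"
    by (rule dvd_diff)
  then show ?case by (simp add: frag_extend_diff bd_diff algebra_simps)
qed (use assms in auto)

section \<open>The dual tiles of a word\<close>

text \<open>The signs and base points contributed by the occurrences of the letters \<open>i\<close> and \<open>i\<inverse>\<close>.\<close>

fun bases :: "2 \<Rightarrow> word \<Rightarrow> (int \<times> (int ^ 2)) list" where
  "bases i [] = []"
| "bases i (l # w) = (if l = Gen i then [(1, abel w)]
     else if l = Inv i then [(- 1, abel (l # w))] else []) @ bases i w"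

text \<open>The image of one symbol under the tiling substitution, with sets of positions replaced
  by lists that can be computed by recursion on concrete words.\<close>

definition dual_tile :: "endo \<Rightarrow> symb \<Rightarrow> chain" where
  "dual_tile \<sigma> = (\<lambda>(x, i). \<Sum>j\<in>UNIV. \<Sum>(s, b)\<leftarrow>bases i (\<sigma> j).
     frag_cmul s (frag_of (matrix_inv (inc_mat \<sigma>) *v (x + b), j)))"

lemma occ_Cons: "occ (l # w) m = (if l = m then {0} else {}) \<union> Suc ` occ w m"
proof (intro set_eqI iffI)
  fix k assume "k \<in> occ (l # w) m"
  then show "k \<in> (if l = m then {0} else {}) \<union> Suc ` occ w m"
    by (cases k) (auto simp: occ_def)
qed (auto simp: occ_def split: if_splits)

lemma finite_occ [simp]: "finite (occ w m)"
  by (simp add: occ_def)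

lemma sum_occ_Cons:
  fixes F :: "nat \<Rightarrow> 'a::comm_monoid_add"
  shows "sum F (occ (l # w) m) = (if l = m then F 0 else 0) + (\<Sum>k\<in>occ w m. F (Suc k))"
proof -
  have "sum F (occ (l # w) m) = sum F (if l = m then {0} else {}) + sum F (Suc ` occ w m)"
    unfolding occ_Cons by (rule sum.union_disjoint) auto
  also have "sum F (Suc ` occ w m) = (\<Sum>k\<in>occ w m. F (Suc k))"
    by (simp add: sum.reindex)
  finally show ?thesis by auto
qed

text \<open>Putting a letter in front raises every position by one and leaves the suffixes alone;
  this turns the sums over positions into a recursion on the word.\<close>

lemma sum_occ_conv_bases:
  "(\<Sum>k\<in>occ w (Gen i). F (abel (drop (Suc k) w))) - (\<Sum>k\<in>occ w (Inv i). F (abel (drop k w)))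
   = (\<Sum>(s, b)\<leftarrow>bases i w. frag_cmul s (F b))"
proof (induction w)
  case Nil
  then show ?case by (simp add: occ_def)
next
  case (Cons l w)
  show ?case
    using Cons by (auto simp: sum_occ_Cons algebra_simps)
qed

lemma tile_subst_eq: "tile_subst \<sigma> = frag_extend (dual_tile \<sigma>)"
  unfolding tile_subst_def dual_tile_def
  by (rule arg_cong[where f = frag_extend], rule ext, clarify, rule sum.cong[OF refl])
     (rule sum_occ_conv_bases)

lemma keys_sum_list: "Poly_Mapping.keys (sum_list gs) \<subseteq> (\<Union>g\<in>set gs. Poly_Mapping.keys g)"
proof (induction gs)
  case (Cons g gs)
  then show ?case using keys_add[of g "sum_list gs"] by auto
qed simp

lemma keys_dual_tile:
  assumes "(y, j) \<in> Poly_Mapping.keys (dual_tile \<sigma> (x, i))"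
  shows "\<exists>b\<in>snd ` set (bases i (\<sigma> j)). y = matrix_inv (inc_mat \<sigma>) *v (x + b)"
proof -
  from assms obtain j' where "(y, j) \<in> Poly_Mapping.keys (\<Sum>(s, b)\<leftarrow>bases i (\<sigma> j').
     frag_cmul s (frag_of (matrix_inv (inc_mat \<sigma>) *v (x + b), j')))"
    unfolding dual_tile_def using keys_sum by fastforce
  then obtain s b where "(s, b) \<in> set (bases i (\<sigma> j'))"
     "(y, j) \<in> Poly_Mapping.keys (frag_cmul s (frag_of (matrix_inv (inc_mat \<sigma>) *v (x + b), j')))"
    using keys_sum_list by fastforce
  then show ?thesis by force
qed

lemma sign_bases: "(s, b) \<in> set (bases i w) \<Longrightarrow> s = 1 \<or> s = - 1"
  by (induction w) (auto split: if_splits)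

text \<open>Modulo 2 the signs \<open>1\<close> and \<open>- 1\<close> agree, so the signs of
  inverse letters drop out of the boundary computation.\<close>

lemma even_sum_list_sign:
  fixes F :: "'a \<Rightarrow> int"
  assumes "\<And>s b. (s, b) \<in> set xs \<Longrightarrow> s = 1 \<or> s = - 1"
  shows "even ((\<Sum>(s, b)\<leftarrow>xs. s * F b) - (\<Sum>b\<leftarrow>map snd xs. F b))"
  using assms
proof (induction xs)
  case (Cons p xs)
  obtain s b where p: "p = (s, b)" by force
  have "s = 1 \<or> s = - 1" using Cons.prems[of s b] p by simp
  then have "even (s * F b - F b)" by auto
  moreover have "even ((\<Sum>(s, b)\<leftarrow>xs. s * F b) - (\<Sum>b\<leftarrow>map snd xs. F b))"
    using Cons by auto
  ultimately have "even ((s * F b - F b) + ((\<Sum>(s, b)\<leftarrow>xs. s * F b) - (\<Sum>b\<leftarrow>map snd xs. F b)))"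
    by (rule dvd_add)
  then show ?case by (simp add: p algebra_simps)
qed simp

section \<open>Linear algebra of the two eigenlines\<close>

text \<open>\<open>matrix_inv\<close> is given by choice, so an inverse over the integers has to be
  exhibited first.\<close>

lemma matrix_inv_mult_int:
  fixes A :: "int ^ 2 ^ 2"
  assumes "det A = 1 \<or> det A = - 1"
  shows "A *v (matrix_inv A *v x) = x" "matrix_inv A *v (A *v x) = x"
proof -
  \<comment> \<open>The adjugate times \<open>det A\<close>; a determinant \<open>1\<close> or
    \<open>- 1\<close> is its own inverse.\<close>
  define B :: "int ^ 2 ^ 2" where
    "B = (\<chi> i j. det A * (if i = 1 then (if j = 1 then A $ 2 $ 2 else - A $ 1 $ 2)
        else (if j = 1 then - A $ 2 $ 1 else A $ 1 $ 1)))"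
  have "det A * det A = 1" using assms by auto
  then have *: "det A * (A $ 1 $ 1 * A $ 2 $ 2 - A $ 1 $ 2 * A $ 2 $ 1) = 1"
    by (simp add: det_2)
  have "A ** B = mat 1" "B ** A = mat 1"
    using * by (simp_all add: vec_eq_iff forall_2 matrix_matrix_mult_def sum_2 B_def mat_def algebra_simps)
  then have "A ** matrix_inv A = mat 1 \<and> matrix_inv A ** A = mat 1"
    unfolding matrix_inv_def by (intro someI[of "\<lambda>A'. A ** A' = mat 1 \<and> A' ** A = mat 1" B]) auto
  then show "A *v (matrix_inv A *v x) = x" "matrix_inv A *v (A *v x) = x"
    by (simp_all add: matrix_vector_mul_assoc)
qed

lemma real_vec_add: "real_vec (x + y) = real_vec x + real_vec y"
  by (simp add: real_vec_def vec_eq_iff)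

lemma real_vec_mult: "real_vec (inc_mat \<sigma> *v x) = real_mat \<sigma> *v real_vec x"
  by (simp add: real_vec_def real_mat_def vec_eq_iff matrix_vector_mult_def)

lemma inc_mat_axis: "inc_mat \<sigma> *v axis j 1 = abel (\<sigma> j)"
  by (simp add: inc_mat_def vec_eq_iff matrix_vector_mult_def axis_def if_distrib[of "(*) _"] cong: if_cong)

text \<open>\<open>(\<alpha>, \<beta>)\<close> is a left eigenvector for \<open>\<kappa>'\<close>, so that \<open>form\<close> vanishes on the expanding line and
  is a coordinate on the contracting line.\<close>

locale contracting_form =
  fixes \<rho> :: endo and \<alpha> \<beta> \<kappa> \<kappa>' :: real
  assumes det: "det (inc_mat \<rho>) = 1 \<or> det (inc_mat \<rho>) = - 1"
    and left1: "\<alpha> * real_mat \<rho> $ 1 $ 1 + \<beta> * real_mat \<rho> $ 2 $ 1 = \<kappa>' * \<alpha>"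
    and left2: "\<alpha> * real_mat \<rho> $ 1 $ 2 + \<beta> * real_mat \<rho> $ 2 $ 2 = \<kappa>' * \<beta>"
    and trace: "real_mat \<rho> $ 1 $ 1 + real_mat \<rho> $ 2 $ 2 = \<kappa> + \<kappa>'"
    and alpha: "\<alpha> \<noteq> 0" and expanding: "\<bar>\<kappa>\<bar> > 1" and contracting: "\<bar>\<kappa>'\<bar> < 1" and nonzero: "\<kappa>' \<noteq> 0"
begin

definition form :: "real ^ 2 \<Rightarrow> real" where
  "form v = \<alpha> * v $ 1 + \<beta> * v $ 2"

definition iform :: "int ^ 2 \<Rightarrow> real" where
  "iform x = form (real_vec x)"

definition B :: "int ^ 2 ^ 2" where
  "B = matrix_inv (inc_mat \<rho>)"

text \<open>By Cayley-Hamilton the columns of \<open>A - \<kappa> I\<close> are right eigenvectors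
  for \<kappa>'. This is the first column, scaled so that \<open>form dir = 1\<close>.\<close>

definition dir :: "real ^ 2" where
  "dir = (1 / ((\<kappa>' - \<kappa>) * \<alpha>)) *\<^sub>R vector [real_mat \<rho> $ 1 $ 1 - \<kappa>, real_mat \<rho> $ 2 $ 1]"

lemma form_add: "form (v + w) = form v + form w"
  and form_diff: "form (v - w) = form v - form w"
  and form_scale: "form (k *\<^sub>R v) = k * form v"
  by (simp_all add: form_def algebra_simps)

lemma iform_add: "iform (x + y) = iform x + iform y"
  by (simp add: iform_def real_vec_add form_add)

lemma form_mult: "form (real_mat \<rho> *v v) = \<kappa>' * form v"
proof -
  have "form (real_mat \<rho> *v v) = (\<alpha> * real_mat \<rho> $ 1 $ 1 + \<beta> * real_mat \<rho> $ 2 $ 1) * v $ 1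
     + (\<alpha> * real_mat \<rho> $ 1 $ 2 + \<beta> * real_mat \<rho> $ 2 $ 2) * v $ 2"
    by (simp add: form_def matrix_vector_mult_def sum_2 algebra_simps)
  then show ?thesis unfolding left1 left2 by (simp add: form_def algebra_simps)
qed

lemma B_mult: "inc_mat \<rho> *v (B *v x) = x" "B *v (inc_mat \<rho> *v x) = x"
  using matrix_inv_mult_int[OF det] by (simp_all add: B_def)

lemma iform_B: "\<kappa>' * iform (B *v x) = iform x"
  using form_mult[of "real_vec (B *v x)"] by (simp add: iform_def B_mult flip: real_vec_mult)

lemma kappa_neq: "\<kappa>' - \<kappa> \<noteq> 0"
  using expanding contracting by auto

lemma form_dir: "form dir = 1"
proof -
  have "form dir = ((\<alpha> * real_mat \<rho> $ 1 $ 1 + \<beta> * real_mat \<rho> $ 2 $ 1) - \<alpha> * \<kappa>) / ((\<kappa>' - \<kappa>) * \<alpha>)"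
    unfolding dir_def form_scale by (simp add: form_def right_diff_distrib)
  also have "\<dots> = ((\<kappa>' - \<kappa>) * \<alpha>) / ((\<kappa>' - \<kappa>) * \<alpha>)"
    unfolding left1 by (simp add: algebra_simps)
  finally show ?thesis using kappa_neq alpha by simp
qed

text \<open>The locale introduces \<kappa> through the trace only. Multiplying the determinant by
  \<alpha> and eliminating with the left eigenvector equations shows that \<kappa> is the second
  root of the characteristic polynomial.\<close>

lemma det_eq: "real_mat \<rho> $ 1 $ 1 * real_mat \<rho> $ 2 $ 2 - real_mat \<rho> $ 1 $ 2 * real_mat \<rho> $ 2 $ 1 = \<kappa> * \<kappa>'"
proof -
  let ?m = "\<lambda>i j. real_mat \<rho> $ i $ j"
  have "\<alpha> * (?m 1 1 * ?m 2 2 - ?m 1 2 * ?m 2 1) =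
     (\<alpha> * ?m 1 1 + \<beta> * ?m 2 1) * ?m 2 2 - (\<alpha> * ?m 1 2 + \<beta> * ?m 2 2) * ?m 2 1"
    by (simp add: algebra_simps)
  also have "\<dots> = \<kappa>' * (\<alpha> * ?m 2 2 - \<beta> * ?m 2 1)"
    unfolding left1 left2 by (simp add: algebra_simps)
  also have "\<beta> * ?m 2 1 = \<kappa>' * \<alpha> - \<alpha> * ?m 1 1" using left1 by simp
  also have "\<alpha> * ?m 2 2 - (\<kappa>' * \<alpha> - \<alpha> * ?m 1 1) = \<alpha> * ((?m 1 1 + ?m 2 2) - \<kappa>')"
    by (simp add: algebra_simps)
  finally show ?thesis using alpha unfolding trace by simp
qed

lemma mult_dir: "real_mat \<rho> *v dir = \<kappa>' *\<^sub>R dir"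
proof -
  let ?m = "\<lambda>i j. real_mat \<rho> $ i $ j"
  let ?u = "vector [?m 1 1 - \<kappa>, ?m 2 1] :: real ^ 2"
  have k: "\<kappa>' = ?m 1 1 + ?m 2 2 - \<kappa>" using trace by simp
  have "?m 1 1 * (?m 1 1 - \<kappa>) + ?m 1 2 * ?m 2 1 = \<kappa>' * (?m 1 1 - \<kappa>)"
    using det_eq unfolding k by (simp add: algebra_simps)
  moreover have "?m 2 1 * (?m 1 1 - \<kappa>) + ?m 2 2 * ?m 2 1 = \<kappa>' * ?m 2 1"
    unfolding k by (simp add: algebra_simps)
  ultimately have "real_mat \<rho> *v ?u = \<kappa>' *\<^sub>R ?u"
    by (simp add: vec_eq_iff forall_2 matrix_vector_mult_def sum_2)
  then show ?thesis by (simp add: dir_def matrix_vector_mult_scaleR)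
qed

lemma form_eq_0:
  assumes "form v = 0"
  shows "v = (- (v $ 2 / \<alpha>)) *\<^sub>R vector [\<beta>, - \<alpha>]"
  using assms alpha by (simp add: form_def vec_eq_iff forall_2 field_simps)

text \<open>The kernel of a left eigenvector for \<kappa>' is the right eigenline for the other
  eigenvalue; it is spanned by \<open>vector [\<beta>, - \<alpha>]\<close>.\<close>

lemma mult_form_0:
  assumes "form v = 0"
  shows "real_mat \<rho> *v v = \<kappa> *\<^sub>R v"
proof -
  let ?m = "\<lambda>i j. real_mat \<rho> $ i $ j"
  have k: "\<kappa> = ?m 1 1 + ?m 2 2 - \<kappa>'" using trace by simp
  have "real_mat \<rho> *v vector [\<beta>, - \<alpha>] = \<kappa> *\<^sub>R vector [\<beta>, - \<alpha>]"
    using left1 left2 unfolding k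
    by (simp add: vec_eq_iff forall_2 matrix_vector_mult_def sum_2 algebra_simps)
  moreover obtain t where "v = t *\<^sub>R vector [\<beta>, - \<alpha>]"
    using form_eq_0[OF assms] by blast
  ultimately show ?thesis
    by (simp add: matrix_vector_mult_scaleR)
qed

lemma dir_decomp: "form (v - form v *\<^sub>R dir) = 0"
  by (simp add: form_diff form_scale form_dir)

lemma mult_decomp:
  "real_mat \<rho> *v v = (\<kappa>' * form v) *\<^sub>R dir + \<kappa> *\<^sub>R (v - form v *\<^sub>R dir)"
proof -
  have "real_mat \<rho> *v v = real_mat \<rho> *v (form v *\<^sub>R dir) + real_mat \<rho> *v (v - form v *\<^sub>R dir)"
    by (simp flip: matrix_vector_right_distrib)
  then show ?thesis
    by (simp add: mult_form_0[OF dir_decomp] matrix_vector_mult_scaleR mult_dir)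
qed

lemma eigenspace_contracting: "eigenspace (real_mat \<rho>) \<kappa>' = range (\<lambda>s. s *\<^sub>R dir)"
proof
  show "range (\<lambda>s. s *\<^sub>R dir) \<subseteq> eigenspace (real_mat \<rho>) \<kappa>'"
    by (auto simp: eigenspace_def matrix_vector_mult_scaleR mult_dir)
  show "eigenspace (real_mat \<rho>) \<kappa>' \<subseteq> range (\<lambda>s. s *\<^sub>R dir)"
  proof
    fix v assume "v \<in> eigenspace (real_mat \<rho>) \<kappa>'"
    then have "(\<kappa>' * form v) *\<^sub>R dir + \<kappa> *\<^sub>R (v - form v *\<^sub>R dir) = \<kappa>' *\<^sub>R v"
      by (simp add: eigenspace_def mult_decomp)
    then have "(\<kappa>' - \<kappa>) *\<^sub>R (v - form v *\<^sub>R dir) = 0"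
      by (simp add: algebra_simps)
    then show "v \<in> range (\<lambda>s. s *\<^sub>R dir)" using kappa_neq by auto
  qed
qed

lemma eigenspace_expanding: "eigenspace (real_mat \<rho>) \<kappa> = {v. form v = 0}"
proof
  show "{v. form v = 0} \<subseteq> eigenspace (real_mat \<rho>) \<kappa>"
    by (auto simp: eigenspace_def mult_form_0)
  show "eigenspace (real_mat \<rho>) \<kappa> \<subseteq> {v. form v = 0}"
  proof
    fix v assume "v \<in> eigenspace (real_mat \<rho>) \<kappa>"
    then have "\<kappa> * form v = \<kappa>' * form v"
      using form_mult[of v] by (simp add: eigenspace_def form_scale)
    then show "v \<in> {v. form v = 0}" using kappa_neq by auto
  qed
qed

lemma dir_nonzero: "dir \<noteq> 0"
  using form_dir by (auto simp: form_def)

text \<open>Needed to resolve the definite descriptions of the two eigenvalues. If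
  \<open>form\<close> vanishes on an eigenvector, the eigenvalue is \<kappa>; otherwise comparing
  the forms of both sides gives \<kappa>'.\<close>

lemma eigenvalue_iff: "is_eigenvalue (real_mat \<rho>) k \<longleftrightarrow> k = \<kappa> \<or> k = \<kappa>'"
proof
  assume "is_eigenvalue (real_mat \<rho>) k"
  then obtain v where v: "v \<noteq> 0" "real_mat \<rho> *v v = k *\<^sub>R v"
    by (auto simp: is_eigenvalue_def)
  then have "\<kappa>' * form v = k * form v" by (metis form_mult form_scale)
  moreover have "k = \<kappa>" if "form v = 0" using mult_form_0[OF that] v by simp
  ultimately show "k = \<kappa> \<or> k = \<kappa>'" by (metis mult_right_cancel)
next
  have "form (vector [\<beta>, - \<alpha>]) = 0" "(vector [\<beta>, - \<alpha>] :: real ^ 2) \<noteq> 0"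
    using alpha by (auto simp: form_def vec_eq_iff forall_2)
  then show "k = \<kappa> \<or> k = \<kappa>' \<Longrightarrow> is_eigenvalue (real_mat \<rho>) k"
    using mult_form_0 mult_dir dir_nonzero by (auto simp: is_eigenvalue_def)
qed

lemma contracting_line_eq: "contracting_line \<rho> = range (\<lambda>s. s *\<^sub>R dir)"
proof -
  have "contracting_eigenvalue (real_mat \<rho>) = \<kappa>'"
    unfolding contracting_eigenvalue_def
    by (rule the_equality) (use contracting expanding in \<open>auto simp: eigenvalue_iff\<close>)
  then show ?thesis by (simp add: contracting_line_def eigenspace_contracting)
qed

lemma expanding_line_eq: "expanding_line \<rho> = {v. form v = 0}"
proof -
  have "expanding_eigenvalue (real_mat \<rho>) = \<kappa>"
    unfolding expanding_eigenvalue_def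
    by (rule the_equality) (use contracting expanding in \<open>auto simp: eigenvalue_iff\<close>)
  then show ?thesis by (simp add: expanding_line_def eigenspace_expanding)
qed

text \<open>\<open>dir_decomp\<close> splits \<open>v\<close> along the two eigenlines, so the
  single number \<open>form v\<close> determines the projection.\<close>

lemma proj_eq: "proj \<rho> v = form v *\<^sub>R dir"
  unfolding proj_def
proof (rule the_equality)
  show "form v *\<^sub>R dir \<in> contracting_line \<rho> \<and> v - form v *\<^sub>R dir \<in> expanding_line \<rho>"
    by (auto simp: contracting_line_eq expanding_line_eq dir_decomp)
  show "p = form v *\<^sub>R dir" if "p \<in> contracting_line \<rho> \<and> v - p \<in> expanding_line \<rho>" for p
    using that by (auto simp: contracting_line_eq expanding_line_eq form_diff form_scale form_dir)
qed

lemma funpow_mult_dir: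
  "((\<lambda>v. real_mat \<rho> *v v) ^^ n) (s *\<^sub>R dir) = (\<kappa>' ^ n * s) *\<^sub>R dir"
  by (induction n) (simp_all add: matrix_vector_mult_scaleR mult_dir mult_ac)

lemma rescaled_projection:
  "((\<lambda>v. real_mat \<rho> *v v) ^^ n) ` proj \<rho> ` S = (\<lambda>y. (\<kappa>' ^ n * form y) *\<^sub>R dir) ` S"
  by (simp add: image_image proj_eq funpow_mult_dir)

end

section \<open>Arcs on the contracting line and their images under intertwining matrices\<close>

context contracting_form
begin

text \<open>The end points are given in the coordinate \<open>form\<close> and in either order,
  since signed lengths of projected tiles may be negative.\<close>

definition arc :: "real \<Rightarrow> real \<Rightarrow> (real ^ 2) set" where
  "arc l h = (\<lambda>s. s *\<^sub>R dir) ` closed_segment l h"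

lemma arc_commute: "arc l h = arc h l"
  by (simp add: arc_def closed_segment_commute)

lemma arc_Un_eq:
  "closed_segment l h \<union> closed_segment l' h' = closed_segment l'' h'' \<Longrightarrow> arc l h \<union> arc l' h' = arc l'' h''"
  unfolding arc_def image_Un[symmetric] by simp

lemma is_interval_arc: "l \<noteq> h \<Longrightarrow> is_interval_in (contracting_line \<rho>) (arc l h)"
proof -
  assume "l \<noteq> h"
  then have "l *\<^sub>R dir \<noteq> h *\<^sub>R dir" using dir_nonzero by simp
  moreover have "arc l h = closed_segment (l *\<^sub>R dir) (h *\<^sub>R dir)"
    unfolding arc_def by (rule closed_segment_linear_image[symmetric]) (simp add: linear_scaleR_left)
  ultimately show ?thesis
    unfolding is_interval_in_def contracting_line_eq by blast
qed

text \<open>\<open>line_null\<close> measures with a unit vector, so coordinates along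
  \<open>dir\<close> are rescaled by \<open>norm dir\<close>; the intersection has at most one
  point.\<close>

lemma line_null_arc_Int:
  assumes "closed_segment l h \<inter> closed_segment l' h' \<subseteq> {m}"
  shows "line_null (contracting_line \<rho>) (arc l h \<inter> arc l' h')"
proof -
  define u where "u = (1 / norm dir) *\<^sub>R dir"
  have nd: "norm dir \<noteq> 0" using dir_nonzero by simp
  have "norm u = 1" using nd by (simp add: u_def)
  moreover have "contracting_line \<rho> = span {u}"
  proof -
    have "range (\<lambda>s. s *\<^sub>R dir) = range (\<lambda>s. s *\<^sub>R u)"
    proof (intro antisym image_subsetI)
      fix s
      have "s *\<^sub>R dir = (s * norm dir) *\<^sub>R u" using nd by (simp add: u_def)
      then show "s *\<^sub>R dir \<in> range (\<lambda>s. s *\<^sub>R u)" by blast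
      have "s *\<^sub>R u = (s / norm dir) *\<^sub>R dir" by (simp add: u_def)
      then show "s *\<^sub>R u \<in> range (\<lambda>s. s *\<^sub>R dir)" by blast
    qed
    then show ?thesis by (simp add: contracting_line_eq span_singleton)
  qed
  moreover have "{s. s *\<^sub>R u \<in> arc l h \<inter> arc l' h'} \<subseteq> {m * norm dir}"
  proof clarify
    fix s assume "s *\<^sub>R u \<in> arc l h" "s *\<^sub>R u \<in> arc l' h'"
    then obtain r r' where r: "r \<in> closed_segment l h" "s *\<^sub>R u = r *\<^sub>R dir"
        "r' \<in> closed_segment l' h'" "s *\<^sub>R u = r' *\<^sub>R dir"
      unfolding arc_def by blast
    then have rr: "r = r'" using dir_nonzero by simp
    have "(s / norm dir) *\<^sub>R dir = r *\<^sub>R dir" using r(2) by (simp add: u_def)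
    then have "s / norm dir = r" using dir_nonzero by simp
    moreover have "r = m" using assms r rr by blast
    ultimately show "s = m * norm dir" using nd by (simp add: field_simps)
  qed
  then have "{s. s *\<^sub>R u \<in> arc l h \<inter> arc l' h'} \<in> null_sets lebesgue"
    using finite_imp_null_set_lborel[of "{m * norm dir}"]
    by (meson completion.complete2 null_sets_completionI finite.emptyI finite.insertI)
  ultimately show ?thesis
    unfolding line_null_def by blast
qed

text \<open>The intertwining relation carries the \<kappa>'-eigenline of \<open>\<rho>2\<close> into
  that of \<rho>, and the normalisation of \<open>dir\<close> by \<open>form\<close> forces the
  scalar to be 1.\<close>

lemma intertwining_dir:
  assumes "contracting_form \<rho>2 \<alpha>2 \<beta>2 \<kappa>2 \<kappa>'"
    and A: "real_mat \<rho> ** A = A ** real_mat \<rho>2"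
    and form: "\<And>v. form (A *v v) = contracting_form.form \<alpha>2 \<beta>2 v"
  shows "A *v contracting_form.dir \<rho>2 \<alpha>2 \<kappa>2 \<kappa>' = dir"
proof -
  interpret other: contracting_form \<rho>2 \<alpha>2 \<beta>2 \<kappa>2 \<kappa>' by fact
  let ?v = "A *v other.dir"
  have "real_mat \<rho> *v ?v = A *v (real_mat \<rho>2 *v other.dir)"
    by (simp add: matrix_vector_mul_assoc A)
  then have "?v \<in> eigenspace (real_mat \<rho>) \<kappa>'"
    by (simp add: other.mult_dir eigenspace_def matrix_vector_mult_scaleR)
  then obtain s where s: "?v = s *\<^sub>R dir"
    unfolding eigenspace_contracting by blast
  have "form ?v = 1" by (simp add: form other.form_dir)
  then show ?thesis by (simp add: s form_scale form_dir)
qed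

text \<open>By \<open>intertwining_dir\<close> the matrix \<open>A\<close> is the identity in the
  two coordinates, so only the translation by \<open>form x\<close> or its negative remains.\<close>

lemma affine_image_arc:
  assumes "contracting_form \<rho>2 \<alpha>2 \<beta>2 \<kappa>2 \<kappa>'"
    and "real_mat \<rho> ** A = A ** real_mat \<rho>2"
    and "\<And>v. form (A *v v) = contracting_form.form \<alpha>2 \<beta>2 v"
  shows "(\<lambda>v. proj \<rho> x + A *v v) ` contracting_form.arc \<rho>2 \<alpha>2 \<kappa>2 \<kappa>' l h = arc (l + form x) (h + form x)"
    and "(\<lambda>v. - proj \<rho> x + A *v v) ` contracting_form.arc \<rho>2 \<alpha>2 \<kappa>2 \<kappa>' l h = arc (l - form x) (h - form x)"
proof -
  have *: "(\<lambda>v. r *\<^sub>R dir + A *v v) ` contracting_form.arc \<rho>2 \<alpha>2 \<kappa>2 \<kappa>' l h = arc (l + r) (h + r)" for r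
  proof -
    have "arc (l + r) (h + r) = (\<lambda>s. s *\<^sub>R dir) ` (+) r ` closed_segment l h"
      unfolding arc_def add.commute[of _ r] closed_segment_translation ..
    then show ?thesis
      unfolding contracting_form.arc_def[OF assms(1)] image_image
      by (simp add: matrix_vector_mult_scaleR intertwining_dir[OF assms] scaleR_add_left)
  qed
  show "(\<lambda>v. proj \<rho> x + A *v v) ` contracting_form.arc \<rho>2 \<alpha>2 \<kappa>2 \<kappa>' l h = arc (l + form x) (h + form x)"
    unfolding proj_eq by (rule *)
  show "(\<lambda>v. - proj \<rho> x + A *v v) ` contracting_form.arc \<rho>2 \<alpha>2 \<kappa>2 \<kappa>' l h = arc (l - form x) (h - form x)"
    using *[of "- form x"] by (simp add: proj_eq)
qed

end

section \<open>The projection of a chain covers the interval between its end points\<close>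

text \<open>The boundary of \<open>g\<close> modulo 2 consists of the points \<open>p\<close> and
  \<open>q\<close> (and is zero if they coincide), tested against all integer functions.\<close>

definition ends_at :: "int ^ 2 \<Rightarrow> int ^ 2 \<Rightarrow> chain \<Rightarrow> bool" where
  "ends_at p q g \<longleftrightarrow> (\<forall>h. even (bd h g - (h p + h q)))"

text \<open>\<open>parity\<close> concerns the image of a tile at the origin before the inverse
  matrix is applied: a tile of type \<open>j\<close> with base \<open>b\<close> then runs from
  \<open>b\<close> to \<open>b + abel (\<rho> (other j))\<close>. Modulo 2 all ends cancel except
  those of the original tile moved by \<open>c\<close>.\<close>

locale dual_tiling = contracting_form +
  fixes c :: "int ^ 2"
  assumes parity: "\<And>(h :: int ^ 2 \<Rightarrow> int) i. even ((\<Sum>j\<in>UNIV. \<Sum>b\<leftarrow>map snd (bases i (\<rho> j)). h b + h (b + abel (\<rho> (other j))))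
     - (h c + h (c + axis (other i) 1)))"
begin

definition shift :: "int ^ 2 \<Rightarrow> int ^ 2" where
  "shift x = B *v (x + c)"

lemma B_abel: "B *v (x + abel (\<rho> j)) = B *v x + axis j 1"
  by (simp add: matrix_vector_right_distrib B_mult flip: inc_mat_axis)

lemma even_bd_dual_tile:
  "even (bd h (dual_tile \<rho> (x, i)) - bd (\<lambda>y. h (shift y)) (frag_of (x, i)))"
proof -
  \<comment> \<open>Pulling \<open>h\<close> back along \<open>b \<mapsto> B *v (x + b)\<close>
    reduces an arbitrary base point \<open>x\<close> to the situation of
    \<open>parity\<close>.\<close>
  define h' where "h' = (\<lambda>b. h (B *v (x + b)))"
  define F where "F = (\<lambda>j b. h' b + h' (b + abel (\<rho> (other j))))"
  have F: "bd h (frag_of (B *v (x + b), j)) = F j b" for b j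
    by (simp add: bd_of F_def h'_def B_abel add.assoc flip: B_abel)
  have "bd h (dual_tile \<rho> (x, i)) = (\<Sum>j\<in>UNIV. \<Sum>(s, b)\<leftarrow>bases i (\<rho> j). s * F j b)"
    by (simp add: dual_tile_def sum_2 bd_add bd_sum_list split_def bd_cmul o_def F flip: B_def)
  moreover have "even (\<dots> - (\<Sum>j\<in>UNIV. \<Sum>b\<leftarrow>map snd (bases i (\<rho> j)). F j b))"
    unfolding sum_subtractf[symmetric]
    by (intro dvd_sum even_sum_list_sign) (rule sign_bases)
  moreover have "even ((\<Sum>j\<in>UNIV. \<Sum>b\<leftarrow>map snd (bases i (\<rho> j)). F j b)
      - (h' c + h' (c + axis (other i) 1)))"
    unfolding F_def by (rule parity)
  moreover have "bd (\<lambda>y. h (shift y)) (frag_of (x, i)) = h' c + h' (c + axis (other i) 1)"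
    by (simp add: bd_of h'_def shift_def add_ac)
  ultimately show ?thesis by simp
qed

lemma ends_at_tile_subst:
  assumes "ends_at p q g"
  shows "ends_at (shift p) (shift q) (tile_subst \<rho> g)"
  unfolding ends_at_def
proof
  fix h
  have "even (bd h (tile_subst \<rho> g) - bd (\<lambda>y. h (shift y)) g)"
    unfolding tile_subst_eq by (rule even_bd_frag_extend) (rule even_bd_dual_tile)
  moreover have "even (bd (\<lambda>y. h (shift y)) g - (h (shift p) + h (shift q)))"
    using assms by (simp add: ends_at_def)
  ultimately show "even (bd h (tile_subst \<rho> g) - (h (shift p) + h (shift q)))"
    by simp
qed

lemma ends_at_funpow:
  "ends_at p q g \<Longrightarrow> ends_at ((shift ^^ n) p) ((shift ^^ n) q) ((tile_subst \<rho> ^^ n) g)"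
  by (induction n) (auto intro: ends_at_tile_subst)

lemma form_segment:
  "form ` segment (x, i) = closed_segment (iform x) (iform (x + axis (other i) 1))"
proof -
  have "linear form"
    by (rule linearI) (simp_all add: form_add form_scale)
  moreover have "real_vec (axis k 1) = axis k 1" for k
    by (simp add: real_vec_def vec_eq_iff axis_def)
  ultimately show ?thesis
    by (simp add: segment_def closed_segment_linear_image iform_def real_vec_add other_def)
qed

text \<open>A discrete intermediate value theorem: if no segment meets \<open>z\<close>, each lies
  strictly on one side of it, so a chain with ends \<open>p\<close> and \<open>q\<close> cannot get
  from one side to the other.\<close>

lemma covering:
  assumes g: "ends_at p q g" and pq: "iform p \<noteq> iform q"
    and z: "z \<in> closed_segment (iform p) (iform q)"
  shows "z \<in> form ` realization g"
proof (rule ccontr)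
  assume neg: "z \<notin> form ` realization g"
  \<comment> \<open>\<open>h1\<close> separates the ends when \<open>z\<close> lies below the larger
    one; \<open>h2\<close> is for \<open>z\<close> equal to the larger one.\<close>
  define h1 where "h1 = (\<lambda>x. if iform x \<le> z then 1 else 0 :: int)"
  define h2 where "h2 = (\<lambda>x. if iform x < z then 1 else 0 :: int)"
  have sides: "even (h1 x + h1 (x + axis (other i) 1)) \<and> even (h2 x + h2 (x + axis (other i) 1))"
    if "(x, i) \<in> Poly_Mapping.keys g" for x i
  proof -
    have "z \<notin> closed_segment (iform x) (iform (x + axis (other i) 1))"
      using neg that unfolding form_segment[symmetric] realization_def by blast
    then show ?thesis
      by (auto simp: h1_def h2_def closed_segment_eq_real_ivl split: if_splits)
  qed
  have "even (bd h1 g) \<and> even (bd h2 g)"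
    unfolding bd_def using sides by (auto intro!: dvd_sum dvd_mult)
  moreover have "even (bd h1 g - (h1 p + h1 q))" "even (bd h2 g - (h2 p + h2 q))"
    using g unfolding ends_at_def by blast+
  ultimately have "even (h1 p + h1 q)" "even (h2 p + h2 q)"
    by simp_all
  then show False
    using z pq by (auto simp: h1_def h2_def closed_segment_eq_real_ivl split: if_splits)
qed

end

section \<open>Rescaled end points, patches, and the limit interval\<close>

lemma closed_segment_scale_shift:
  fixes k x r w :: real
  assumes "r \<in> closed_segment 0 w"
  shows "k * (x + r) \<in> closed_segment (k * x) (k * (x + w))"
proof -
  from assms obtain u where u: "0 \<le> u" "u \<le> 1" "r = u * w"
    by (auto simp: in_segment)
  then have "k * (x + r) = (1 - u) * (k * x) + u * (k * (x + w))"
    by (simp add: algebra_simps)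
  then show ?thesis using u by (auto simp: in_segment)
qed

lemma near_closed_segment:
  fixes a b a' b' x :: real
  assumes "x \<in> closed_segment a b"
  shows "\<exists>y\<in>closed_segment a' b'. \<bar>x - y\<bar> \<le> \<bar>a - a'\<bar> + \<bar>b - b'\<bar>"
proof -
  from assms obtain u where u: "0 \<le> u" "u \<le> 1" "x = (1 - u) * a + u * b"
    by (auto simp: in_segment)
  let ?y = "(1 - u) * a' + u * b'"
  have "x - ?y = (1 - u) * (a - a') + u * (b - b')"
    using u by (simp add: algebra_simps)
  then have "\<bar>x - ?y\<bar> \<le> \<bar>(1 - u) * (a - a')\<bar> + \<bar>u * (b - b')\<bar>"
    by linarith
  also have "\<dots> \<le> 1 * \<bar>a - a'\<bar> + 1 * \<bar>b - b'\<bar>"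
    unfolding abs_mult using u by (intro add_mono mult_right_mono) auto
  finally show ?thesis
    using u by (intro bexI[of _ ?y]) (auto simp: in_segment)
qed

context dual_tiling
begin

text \<open>The sum of the geometric series of the increments in \<open>end_at_Suc\<close>.\<close>

definition offset :: real where
  "offset = iform c / (1 - \<kappa>')"

definition end_at :: "nat \<Rightarrow> int ^ 2 \<Rightarrow> real" where
  "end_at n x = \<kappa>' ^ n * iform ((shift ^^ n) x)"

lemma iform_shift: "\<kappa>' * iform (shift x) = iform x + iform c"
  by (simp add: shift_def iform_B iform_add)

lemma end_at_0: "end_at 0 x = iform x"
  by (simp add: end_at_def)

lemma end_at_Suc: "end_at (Suc n) x = end_at n x + \<kappa>' ^ n * iform c"
proof -
  have "end_at (Suc n) x = \<kappa>' ^ n * (\<kappa>' * iform (shift ((shift ^^ n) x)))"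
    by (simp add: end_at_def mult_ac)
  then show ?thesis
    unfolding iform_shift by (simp add: end_at_def algebra_simps)
qed

text \<open>The correction term does not involve \<open>x\<close>; this is why one offset serves all
  fractals of the same substitution.\<close>

lemma end_at_eq: "end_at n x = iform x + offset * (1 - \<kappa>' ^ n)"
proof (induction n)
  case (Suc n)
  have "1 - \<kappa>' \<noteq> 0" using contracting by auto
  then have c: "iform c = offset * (1 - \<kappa>')" by (simp add: offset_def)
  show ?case
    unfolding end_at_Suc Suc c by (simp add: algebra_simps)
qed (simp add: end_at_0)

lemma kappa'_power: "(\<lambda>n. \<kappa>' ^ n) \<longlonglongrightarrow> 0"
  using contracting by (simp add: LIMSEQ_power_zero)

lemma end_at_limit: "(\<lambda>n. end_at n x) \<longlonglongrightarrow> iform x + offset"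
proof -
  have "(\<lambda>n. iform x + offset * (1 - \<kappa>' ^ n)) \<longlonglongrightarrow> iform x + offset * (1 - 0)"
    by (intro tendsto_intros kappa'_power)
  then show ?thesis by (simp add: end_at_eq)
qed

text \<open>The chains \<open>D (x, i)\<close> are patches that \<open>tile_subst \<rho>\<close> maps to unions of patches, by \<open>E\<close>;
  \<open>w i\<close> is the signed length of the projection of the \<open>i\<close>-th patch up to a bounded error. Trivial
  patches do not always suffice: in the family \<open>T2\<close> only larger patches have images that
  project into the interval they should fill.\<close>

definition patch_system :: "(symb \<Rightarrow> chain) \<Rightarrow> (symb \<Rightarrow> chain) \<Rightarrow> (2 \<Rightarrow> real) \<Rightarrow> real \<Rightarrow> bool" where
  "patch_system D E w C \<longleftrightarrow>
     (\<forall>x i y j. (y, j) \<in> Poly_Mapping.keys (D (x, i)) \<longrightarrow> \<bar>iform y - iform x\<bar> \<le> C) \<and>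
     (\<forall>x i. tile_subst \<rho> (D (x, i)) = frag_extend D (E (x, i))) \<and>
     (\<forall>x i y j. (y, j) \<in> Poly_Mapping.keys (E (x, i)) \<longrightarrow>
        (\<exists>b. y = B *v (x + b) \<and> iform b - iform c \<in> closed_segment 0 (w i)
           \<and> iform b + \<kappa>' * w j - iform c \<in> closed_segment 0 (w i)))"

text \<open>The invariant of the iteration: both nominal ends of every patch lie, after rescaling,
  between the current end points.\<close>

definition inside :: "(2 \<Rightarrow> real) \<Rightarrow> nat \<Rightarrow> int ^ 2 \<Rightarrow> int ^ 2 \<Rightarrow> chain \<Rightarrow> bool" where
  "inside w n p q f \<longleftrightarrow> (\<forall>(x, i)\<in>Poly_Mapping.keys f.
     \<kappa>' ^ n * iform x \<in> closed_segment (end_at n p) (end_at n q) \<and>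
     \<kappa>' ^ n * (iform x + w i) \<in> closed_segment (end_at n p) (end_at n q))"

lemma tile_subst_patches:
  assumes "patch_system D E w C"
  shows "tile_subst \<rho> (frag_extend D f) = frag_extend D (frag_extend E f)"
  using subset_UNIV
proof (induction f rule: frag_induction)
  case (one s)
  obtain x i where "s = (x, i)" by force
  then show ?case using assms by (simp add: patch_system_def)
qed (simp_all add: tile_subst_def frag_extend_diff)

text \<open>Relative to \<open>c\<close>, the parts of a patch stay within the width of that patch,
  and adding \<open>\<kappa>' ^ n * iform c\<close> moves the current interval exactly onto the next
  one.\<close>

lemma inside_step:
  assumes sys: "patch_system D E w C" and f: "inside w n p q f"
  shows "inside w (Suc n) p q (frag_extend E f)"
  unfolding inside_def
proof clarify
  fix y j assume "(y, j) \<in> Poly_Mapping.keys (frag_extend E f)"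
  then obtain x i where xi: "(x, i) \<in> Poly_Mapping.keys f" "(y, j) \<in> Poly_Mapping.keys (E (x, i))"
    using keys_frag_extend by fastforce
  with sys obtain b where b: "y = B *v (x + b)" "iform b - iform c \<in> closed_segment 0 (w i)"
      "iform b + \<kappa>' * w j - iform c \<in> closed_segment 0 (w i)"
    unfolding patch_system_def by blast
  have step: "\<kappa>' ^ n * (iform x + r) + \<kappa>' ^ n * iform c \<in> closed_segment (end_at (Suc n) p) (end_at (Suc n) q)"
    if "r \<in> closed_segment 0 (w i)" for r
  proof -
    have "closed_segment (\<kappa>' ^ n * iform x) (\<kappa>' ^ n * (iform x + w i))
        \<subseteq> closed_segment (end_at n p) (end_at n q)"
      using f xi(1) unfolding inside_def by (intro closed_segment_subset) auto
    then have "\<kappa>' ^ n * (iform x + r) \<in> closed_segment (end_at n p) (end_at n q)"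
      using closed_segment_scale_shift[OF that] by blast
    then show ?thesis
      unfolding end_at_Suc by (auto simp: closed_segment_eq_real_ivl split: if_splits)
  qed
  \<comment> \<open>The extra factor \<kappa>' undoes the matrix \<open>B\<close>.\<close>
  have y: "\<kappa>' ^ Suc n * iform y = \<kappa>' ^ n * (iform x + iform b)"
    using iform_B[of "x + b"] by (simp add: b(1) iform_add mult_ac)
  show "\<kappa>' ^ Suc n * iform y \<in> closed_segment (end_at (Suc n) p) (end_at (Suc n) q) \<and>
    \<kappa>' ^ Suc n * (iform y + w j) \<in> closed_segment (end_at (Suc n) p) (end_at (Suc n) q)"
    using step[OF b(2)] step[OF b(3)] y by (simp add: algebra_simps)
qed

lemma funpow_tile_subst_patches:
  assumes sys: "patch_system D E w C" and f: "inside w 0 p q f"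
  shows "\<exists>f'. (tile_subst \<rho> ^^ n) (frag_extend D f) = frag_extend D f' \<and> inside w n p q f'"
proof (induction n)
  case 0
  then show ?case using f by auto
next
  case (Suc n)
  then obtain f' where "(tile_subst \<rho> ^^ n) (frag_extend D f) = frag_extend D f'" "inside w n p q f'"
    by blast
  then show ?case
    using inside_step[OF sys] tile_subst_patches[OF sys] by auto
qed

lemma iform_axis: "\<bar>iform (axis k 1)\<bar> \<le> \<bar>\<alpha>\<bar> + \<bar>\<beta>\<bar>"
  by (simp add: iform_def form_def real_vec_def axis_def)

text \<open>A point of a patch differs from its base by at most one segment and the spread
  \<open>C\<close>, a bounded error that the rescaling shrinks.\<close>

lemma realization_near:
  assumes sys: "patch_system D E w C" and f: "inside w n p q f"
    and y: "y \<in> realization (frag_extend D f)"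
  shows "\<exists>t\<in>closed_segment (end_at n p) (end_at n q).
     \<bar>\<kappa>' ^ n * form y - t\<bar> \<le> \<bar>\<kappa>'\<bar> ^ n * (\<bar>\<alpha>\<bar> + \<bar>\<beta>\<bar> + C)"
proof -
  obtain z j where zj: "(z, j) \<in> Poly_Mapping.keys (frag_extend D f)" "y \<in> segment (z, j)"
    using y unfolding realization_def by force
  then obtain x i where xi: "(x, i) \<in> Poly_Mapping.keys f" "(z, j) \<in> Poly_Mapping.keys (D (x, i))"
    using keys_frag_extend by fastforce
  have "form y \<in> closed_segment (iform z) (iform (z + axis (other j) 1))"
    using zj(2) unfolding form_segment[symmetric] by blast
  then have "\<bar>form y - iform z\<bar> \<le> \<bar>iform (axis (other j) 1)\<bar>"
    by (auto simp: iform_add closed_segment_eq_real_ivl split: if_splits)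
  moreover have "\<bar>iform z - iform x\<bar> \<le> C"
    using sys xi(2) unfolding patch_system_def by blast
  ultimately have "\<bar>form y - iform x\<bar> \<le> \<bar>\<alpha>\<bar> + \<bar>\<beta>\<bar> + C"
    using iform_axis[of "other j"] by linarith
  then have "\<bar>\<kappa>' ^ n * form y - \<kappa>' ^ n * iform x\<bar> \<le> \<bar>\<kappa>'\<bar> ^ n * (\<bar>\<alpha>\<bar> + \<bar>\<beta>\<bar> + C)"
    unfolding right_diff_distrib[symmetric] abs_mult power_abs by (intro mult_left_mono) auto
  then show ?thesis
    using f xi(1) unfolding inside_def by fast
qed

lemma rauzy_eq:
  assumes sys: "patch_system D E w C"
    and ends: "ends_at p q (frag_extend D f)"
    and f: "inside w 0 p q f" and pq: "iform p \<noteq> iform q"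
  shows "rauzy \<rho> (frag_extend D f) = arc (iform p + offset) (iform q + offset)"
  unfolding rauzy_def rescaled_projection arc_def
proof (rule hausdorff_lim_eqI)
  let ?L = "(\<lambda>s. s *\<^sub>R dir) ` closed_segment (iform p + offset) (iform q + offset)"
  let ?g = "\<lambda>n. (tile_subst \<rho> ^^ n) (frag_extend D f)"
  define d where "d n = \<bar>end_at n p - (iform p + offset)\<bar> + \<bar>end_at n q - (iform q + offset)\<bar>" for n
  \<comment> \<open>The absolute value of \<open>C\<close> keeps the first summand nonnegative,
    which the second inclusion uses.\<close>
  define e where "e n = (\<bar>\<kappa>'\<bar> ^ n * (\<bar>\<alpha>\<bar> + \<bar>\<beta>\<bar> + \<bar>C\<bar>) + d n) * norm dir" for n
  show "compact ?L"
    by (intro compact_continuous_image continuous_intros compact_segment)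
  show "?L \<noteq> {}" by simp
  have "(\<lambda>n. \<bar>\<kappa>'\<bar> ^ n) \<longlonglongrightarrow> 0"
    using contracting by (simp add: LIMSEQ_power_zero)
  moreover have "(\<lambda>n. \<bar>end_at n x - (iform x + offset)\<bar>) \<longlonglongrightarrow> 0" for x
    using end_at_limit[of x] LIM_zero tendsto_rabs_zero by blast
  ultimately have "(\<lambda>n. (\<bar>\<kappa>'\<bar> ^ n * (\<bar>\<alpha>\<bar> + \<bar>\<beta>\<bar> + \<bar>C\<bar>) + d n) * norm dir) \<longlonglongrightarrow> 0"
    unfolding d_def by (intro tendsto_mult_left_zero tendsto_add_zero)
  then show "e \<longlonglongrightarrow> 0" unfolding e_def .
  have dist_dir: "dist (a *\<^sub>R dir) (b *\<^sub>R dir) = \<bar>a - b\<bar> * norm dir" for a b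
    by (simp add: dist_norm flip: scaleR_left_diff_distrib)
  fix n
  show "\<exists>y\<in>?L. dist x y \<le> e n" if x: "x \<in> (\<lambda>y. (\<kappa>' ^ n * form y) *\<^sub>R dir) ` realization (?g n)" for x
  proof -
    obtain y where y: "y \<in> realization (?g n)" "x = (\<kappa>' ^ n * form y) *\<^sub>R dir"
      using x by blast
    obtain f' where f': "?g n = frag_extend D f'" "inside w n p q f'"
      using funpow_tile_subst_patches[OF sys f] by blast
    obtain t where t: "t \<in> closed_segment (end_at n p) (end_at n q)"
       "\<bar>\<kappa>' ^ n * form y - t\<bar> \<le> \<bar>\<kappa>'\<bar> ^ n * (\<bar>\<alpha>\<bar> + \<bar>\<beta>\<bar> + C)"
      using realization_near[OF sys f'(2)] y(1) f'(1) by auto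
    obtain s where s: "s \<in> closed_segment (iform p + offset) (iform q + offset)" "\<bar>t - s\<bar> \<le> d n"
      using near_closed_segment[OF t(1)] unfolding d_def by blast
    have "\<bar>\<kappa>'\<bar> ^ n * (\<bar>\<alpha>\<bar> + \<bar>\<beta>\<bar> + C) \<le> \<bar>\<kappa>'\<bar> ^ n * (\<bar>\<alpha>\<bar> + \<bar>\<beta>\<bar> + \<bar>C\<bar>)"
      by (intro mult_left_mono) auto
    then have "\<bar>\<kappa>' ^ n * form y - s\<bar> \<le> \<bar>\<kappa>'\<bar> ^ n * (\<bar>\<alpha>\<bar> + \<bar>\<beta>\<bar> + \<bar>C\<bar>) + d n"
      using t(2) s(2) by linarith
    then have "dist x (s *\<^sub>R dir) \<le> e n"
      unfolding y(2) dist_dir e_def by (rule mult_right_mono) simp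
    then show ?thesis using s(1) by blast
  qed
  show "\<exists>x\<in>(\<lambda>y. (\<kappa>' ^ n * form y) *\<^sub>R dir) ` realization (?g n). dist x y \<le> e n" if y: "y \<in> ?L" for y
  proof -
    obtain s where s: "s \<in> closed_segment (iform p + offset) (iform q + offset)" "y = s *\<^sub>R dir"
      using y by blast
    obtain t where t: "t \<in> closed_segment (end_at n p) (end_at n q)" "\<bar>s - t\<bar> \<le> d n"
      using near_closed_segment[OF s(1)] unfolding d_def by (metis abs_minus_commute)
    have k: "\<kappa>' ^ n \<noteq> 0" using nonzero by simp
    let ?p = "(shift ^^ n) p" and ?q = "(shift ^^ n) q"
    \<comment> \<open>The two ends move by the same amount, so they stay distinct and
      \<open>covering\<close> applies at every stage.\<close>
    have "end_at n p \<noteq> end_at n q" using pq by (simp add: end_at_eq)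
    then have ne: "iform ?p \<noteq> iform ?q" by (auto simp: end_at_def)
    have "closed_segment (end_at n p) (end_at n q) = (*) (\<kappa>' ^ n) ` closed_segment (iform ?p) (iform ?q)"
      unfolding end_at_def by (rule closed_segment_linear_image) (simp add: linear_times)
    then obtain t' where t': "t' \<in> closed_segment (iform ?p) (iform ?q)" "t = \<kappa>' ^ n * t'"
      using t(1) by auto
    obtain x where x: "x \<in> realization (?g n)" "t' = form x"
      using covering[OF ends_at_funpow[OF ends] ne t'(1)] by blast
    have "\<bar>t - s\<bar> \<le> \<bar>\<kappa>'\<bar> ^ n * (\<bar>\<alpha>\<bar> + \<bar>\<beta>\<bar> + \<bar>C\<bar>) + d n"
      using t(2) by (simp add: abs_minus_commute add_increasing)
    then have "dist ((\<kappa>' ^ n * form x) *\<^sub>R dir) y \<le> e n"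
      unfolding s(2) dist_dir e_def using t'(2) x(2) by (simp add: mult_right_mono)
    then show ?thesis using x(1) by blast
  qed
qed

end

section \<open>Substitutions whose tiles fit\<close>

definition pt :: "int \<Rightarrow> int \<Rightarrow> int ^ 2" where
  "pt p q = vector [p, q]"

lemma pt_nth [simp]: "pt p q $ 1 = p" "pt p q $ 2 = q"
  by (simp_all add: pt_def)

lemma pt_add [simp]: "pt p q + pt r s = pt (p + r) (q + s)"
  and pt_minus [simp]: "- pt p q = pt (- p) (- q)"
  and axis_pt: "axis 1 1 = pt 1 0" "axis 2 1 = pt 0 1"
  and zero_pt: "0 = pt 0 0"
  by (simp_all add: vec_eq_iff forall_2 axis_def)

lemma other_simps [simp]: "other 1 = 2" "other 2 = 1"
  by (simp_all add: other_def)

lemma abel_simps: "abel [] = pt 0 0" "abel (l # w) = letter_vec l + abel w"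
    "abel (u @ v) = abel u + abel v"
    "abel (replicate n (Gen 2)) = pt 0 (int n)" "abel (replicate n (Inv 2)) = pt 0 (- int n)"
  by (simp_all add: abel_def zero_pt[symmetric])
     (induction n; simp add: axis_pt zero_pt)+

text \<open>The base of an inverse letter includes the letter itself, hence \<open>Suc m\<close>
  where a generator has \<open>m\<close>.\<close>

lemma bases_replicate:
  "bases 1 (replicate n (Gen 2) @ w) = bases 1 w"
  "bases 1 (replicate n (Inv 2) @ w) = bases 1 w"
  "bases 2 (replicate n (Gen 2) @ w) = map (\<lambda>m. (1, abel w + pt 0 (int m))) (rev [0..<n]) @ bases 2 w"
  "bases 2 (replicate n (Inv 2) @ w) =
     map (\<lambda>m. (- 1, abel w + pt 0 (- int (Suc m)))) (rev [0..<n]) @ bases 2 w"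
  by (induction n) (auto simp: abel_simps axis_pt add_ac)

lemmas bases_replicate' = bases_replicate[where w = "[]", unfolded append_Nil2]

lemma sum_list_rev_upt: "sum_list (map f (rev [0..<n])) = (\<Sum>m<n. f m)"
  by (induction n) (auto simp: add_ac)

lemma gen_pow_replicate: "k = int n \<Longrightarrow> gen_pow i k = replicate n (Gen i)"
    "k = - int n \<Longrightarrow> gen_pow i k = replicate n (Inv i)"
  by (auto simp: gen_pow_def)

lemma telescope_parity:
  fixes g :: "nat \<Rightarrow> int"
  shows "even (\<Sum>m<n. g m + g (Suc m)) \<longleftrightarrow> (even (g 0) \<longleftrightarrow> even (g n))"
  by (induction n) auto

text \<open>Moving the index of \<open>g\<close> by one changes the sum by \<open>g n - g 0\<close>.
  It compares two runs of tiles whose far ends are one step apart.\<close>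

lemma shift_parity:
  fixes f g :: "nat \<Rightarrow> int"
  shows "even (\<Sum>m<n. f m + g (Suc m)) \<longleftrightarrow>
     (even (\<Sum>m<n. f m + g m) \<longleftrightarrow> (even (g 0) \<longleftrightarrow> even (g n)))"
  by (induction n) auto

context contracting_form
begin

lemma iform_pt: "iform (pt p q) = \<alpha> * p + \<beta> * q"
  by (simp add: iform_def form_def real_vec_def)

lemma iform_abel: "\<kappa>' * iform (axis j 1) = iform (abel (\<rho> j))"
  by (simp add: iform_def real_vec_mult form_mult flip: inc_mat_axis)

end

context dual_tiling
begin

text \<open>The images of single tiles project into the intervals that they should fill. After
  multiplication by \<open>\<kappa>'\<close>, \<open>iform_abel\<close> makes this a condition on the abelianised words only.\<close>

definition fits :: bool where
  "fits \<longleftrightarrow> (\<forall>i j. \<forall>b\<in>snd ` set (bases i (\<rho> j)).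
     iform b - iform c \<in> closed_segment 0 (iform (axis (other i) 1)) \<and>
     iform b + iform (abel (\<rho> (other j))) - iform c \<in> closed_segment 0 (iform (axis (other i) 1)))"

lemma trivial_patches:
  assumes fits
  shows "patch_system frag_of (dual_tile \<rho>) (\<lambda>i. iform (axis (other i) 1)) 0"
  unfolding patch_system_def
proof (intro conjI allI impI)
  fix x i y j
  assume "(y, j) \<in> Poly_Mapping.keys (dual_tile \<rho> (x, i))"
  then obtain b where "b \<in> snd ` set (bases i (\<rho> j))" "y = B *v (x + b)"
    using keys_dual_tile unfolding B_def by blast
  then show "\<exists>b. y = B *v (x + b) \<and> iform b - iform c \<in> closed_segment 0 (iform (axis (other i) 1)) \<and>
    iform b + \<kappa>' * iform (axis (other j) 1) - iform c \<in> closed_segment 0 (iform (axis (other i) 1))"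
    using assms unfolding fits_def iform_abel by blast
qed (auto simp: tile_subst_eq simp flip: frag_expansion)

lemma rauzy_trivial_patches:
  assumes fits and ends: "ends_at p q g" and pq: "iform p \<noteq> iform q"
    and g: "\<And>x i. (x, i) \<in> Poly_Mapping.keys g \<Longrightarrow> iform x \<in> closed_segment (iform p) (iform q)
       \<and> iform x + iform (axis (other i) 1) \<in> closed_segment (iform p) (iform q)"
  shows "rauzy \<rho> g = arc (iform p + offset) (iform q + offset)"
  by (subst frag_expansion, rule rauzy_eq[OF trivial_patches[OF assms(1)]])
    (use ends pq g in \<open>auto simp: inside_def end_at_0 simp flip: frag_expansion\<close>)

end

locale fitting_tiling = dual_tiling +
  assumes fits: fits

lemma (in dual_tiling) ends_at_tile: "ends_at x (x + axis (other i) 1) (frag_of (x, i))"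
  by (simp add: ends_at_def bd_of)

context fitting_tiling
begin

lemma rauzy_tile:
  assumes "iform (axis (other i) 1) \<noteq> 0"
  shows "rauzy \<rho> (frag_of (x, i)) = arc (iform x + offset) (iform x + iform (axis (other i) 1) + offset)"
  using rauzy_trivial_patches[OF fits ends_at_tile, of x i] assms
  by (simp add: iform_add)

lemma rauzy_two_tiles:
  assumes "ends_at p q (frag_of (x, i) + frag_of (y, j))" and "iform p \<noteq> iform q"
    and "\<And>z k. (z, k) \<in> {(x, i), (y, j)} \<Longrightarrow> iform z \<in> closed_segment (iform p) (iform q)
       \<and> iform z + iform (axis (other k) 1) \<in> closed_segment (iform p) (iform q)"
  shows "rauzy \<rho> (frag_of (x, i) + frag_of (y, j)) = arc (iform p + offset) (iform q + offset)"
proof (rule rauzy_trivial_patches[OF fits assms(1,2)])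
  fix z k assume "(z, k) \<in> Poly_Mapping.keys (frag_of (x, i) + frag_of (y, j))"
  then have "(z, k) \<in> {(x, i), (y, j)}"
    using keys_add[of "frag_of (x, i)" "frag_of (y, j)"] by auto
  then show "iform z \<in> closed_segment (iform p) (iform q)
       \<and> iform z + iform (axis (other k) 1) \<in> closed_segment (iform p) (iform q)"
    by (rule assms(3))
qed

end

section \<open>The automorphisms\<close>

declare sigma_aut.simps [simp del] tau_aut.simps [simp del]

text \<open>Measuring \<open>a\<close> from the end of its admissible range by a natural number
  turns the powers into lists, to which \<open>bases_replicate\<close> applies.\<close>

lemma aut1_eq:
  assumes "a = int n + 3"
  shows "sigma_aut T1 a = endo [Gen 2] (replicate (Suc n) (Gen 2) @ [Inv 1, Gen 2, Gen 2])"
    "tau_aut T1 a = endo (replicate n (Gen 2) @ [Gen 1, Gen 2]) (replicate (Suc n) (Gen 2) @ [Gen 1, Gen 2])"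
  using assms
  by (simp_all add: sigma_aut.simps tau_aut.simps gen_pow_replicate(1)[where n = n]
      gen_pow_replicate(1)[where n = "Suc n"] del: replicate_Suc)

lemma aut2_eq:
  assumes "a = - int n - 3"
  shows "sigma_aut T2 a = endo [Gen 2] (Inv 1 # replicate (Suc (Suc (Suc n))) (Inv 2))"
    "tau_aut T2 a = endo (Inv 1 # replicate (Suc n) (Inv 2)) (Inv 1 # replicate (Suc (Suc n)) (Inv 2))"
  using assms
  by (simp_all add: sigma_aut.simps tau_aut.simps gen_pow_replicate(2)[where n = "Suc n"]
      gen_pow_replicate(2)[where n = "Suc (Suc n)"] gen_pow_replicate(2)[where n = "Suc (Suc (Suc n))"]
      del: replicate_Suc)

lemma aut4_eq:
  assumes "a = - int n - 1"
  shows "sigma_aut T4 a = endo [Gen 2] (Gen 1 # replicate (Suc n) (Inv 2))"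
    "tau_aut T4 a = endo [Inv 2] (Inv 1 # replicate (Suc n) (Inv 2))"
  using assms
  by (simp_all add: sigma_aut.simps tau_aut.simps gen_pow_replicate(2)[where n = "Suc n"] del: replicate_Suc)

lemma mat_simps:
  "inc_mat (endo u v) $ i $ 1 = abel u $ i" "inc_mat (endo u v) $ i $ 2 = abel v $ i"
  "real_mat (endo u v) $ i $ 1 = real_of_int (abel u $ i)" "real_mat (endo u v) $ i $ 2 = real_of_int (abel v $ i)"
  by (simp_all add: inc_mat_def real_mat_def endo_def)

lemmas word_simps = bases_replicate bases_replicate' endo_def abel_simps axis_pt

lemma minus_int_commute: "- int n - 1 = - 1 - int n" "- int n - 2 = - 2 - int n" "- int n - 3 = - 3 - int n"
  by simp_all

text \<open>\<open>k\<close> is the contracting root of the characteristic polynomial and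
  \<open>(1, k)\<close> its left eigenvector. The constant \<open>pt (- 1) 2\<close> is the base of
  the only occurrence of the letter 1 or its inverse.\<close>

lemma sigma1_tiling:
  fixes k :: real
  assumes "a = int n + 3" "0 < k" "k < 1 / 2" "k ^ 2 = a * k - 1"
  shows "dual_tiling (sigma_aut T1 a) 1 k (a - k) k (pt (- 1) 2)"
  unfolding aut1_eq[OF assms(1)]
proof (unfold_locales, goal_cases)
  \<comment> \<open>The ninth goal is \<open>parity\<close>; the other eight are arithmetic with the
    incidence matrix. The run of letters 2 gives consecutive tiles whose common ends cancel.\<close>
  case (9 h i)
  show ?case
    using telescope_parity[of "\<lambda>m. h (pt (- 1) (2 + int m))" n] exhaust_2[of i]
    by (elim disjE; hypsubst?;
        simp add: assms(1) sum_2 sum_list_rev_upt word_simps o_def algebra_simps del: replicate_Suc;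
        (simp add: minus_int_commute; argo)?)
qed (use assms(2-) arg_cong[OF assms(1), of real_of_int] in
    \<open>simp_all add: det_2 mat_simps abel_simps axis_pt power2_eq_square algebra_simps del: replicate_Suc\<close>)

text \<open>The tile coming from the image of 1 has an end at \<open>1 - 2 * k\<close> relative to
  the constant, so \<open>k < 1 / 2\<close> keeps it in the unit interval.\<close>

lemma sigma1_fits:
  fixes k :: real
  assumes "a = int n + 3" "0 < k" "k < 1 / 2" "k ^ 2 = a * k - 1"
  shows "fitting_tiling (sigma_aut T1 a) 1 k (a - k) k (pt (- 1) 2)"
proof -
  interpret dual_tiling "sigma_aut T1 a" 1 k "a - k" k "pt (- 1) 2"
    by (rule sigma1_tiling[OF assms])
  \<comment> \<open>Linear arithmetic treats the products as atoms, so their bounds are supplied for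
    each position in a run.\<close>
  have multiples: "0 \<le> k * real m \<and> k * real m + k \<le> k * real n" if "m < n" for m
    using mult_left_mono[of "real (Suc m)" "real n" k] that assms by (auto simp: algebra_simps)
  have square: "k * k = k * real n + 3 * k - 1"
    using assms(1,4) by (simp add: power2_eq_square algebra_simps)
  have bounds: "0 \<le> k * real n" "0 < k * k" "k * k < k / 2"
    using assms by auto
  have fits
    unfolding fits_def unfolding aut1_eq[OF assms(1)]
  proof (intro allI, goal_cases)
    case (1 i j)
    show ?case
      using exhaust_2[of i] exhaust_2[of j]
      by (elim disjE; hypsubst;
          auto simp: word_simps iform_pt assms(1) image_Un ball_Un image_image
            closed_segment_eq_real_ivl algebra_simps simp del: replicate_Suc;
          insert square bounds assms(2,3))
        (linarith | (drule multiples, elim conjE, linarith))+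
  qed
  then show ?thesis
    by unfold_locales
qed

text \<open>\<open>(k - 1, k)\<close> is the form \<open>(1, k)\<close> pulled back along the matrix
  of \<open>delta_aut_inv T1\<close>. Both occurrences of 1 have base \<open>pt 0 1\<close>, which
  cancels modulo 2; the remaining ends determine the constant.\<close>

lemma tau1_tiling:
  fixes k :: real
  assumes "a = int n + 3" "0 < k" "k < 1 / 2" "k ^ 2 = a * k - 1"
  shows "dual_tiling (tau_aut T1 a) (k - 1) k (a - k) k (pt 1 (a - 1))"
  unfolding aut1_eq[OF assms(1)]
proof (unfold_locales, goal_cases)
  case (9 h i)
  show ?case
    using shift_parity[of "\<lambda>m. h (pt 1 (1 + int m))" "\<lambda>m. h (pt 2 (2 + int m + int n))" n] exhaust_2[of i]
    by (elim disjE; hypsubst?;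
        simp add: assms(1) sum_2 sum_list_rev_upt word_simps o_def algebra_simps del: replicate_Suc;
        (simp add: minus_int_commute; argo)?)
qed (use assms(2-) arg_cong[OF assms(1), of real_of_int] in
    \<open>simp_all add: det_2 mat_simps abel_simps axis_pt power2_eq_square algebra_simps del: replicate_Suc\<close>)

lemma tau1_fits:
  fixes k :: real
  assumes "a = int n + 3" "0 < k" "k < 1 / 2" "k ^ 2 = a * k - 1"
  shows "fitting_tiling (tau_aut T1 a) (k - 1) k (a - k) k (pt 1 (a - 1))"
proof -
  interpret dual_tiling "tau_aut T1 a" "k - 1" k "a - k" k "pt 1 (a - 1)"
    by (rule tau1_tiling[OF assms])
  have multiples: "0 \<le> k * real m \<and> k * real m + k \<le> k * real n" if "m < n" for m
    using mult_left_mono[of "real (Suc m)" "real n" k] that assms by (auto simp: algebra_simps)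
  have square: "k * k = k * real n + 3 * k - 1"
    using assms(1,4) by (simp add: power2_eq_square algebra_simps)
  have bounds: "0 \<le> k * real n" "0 < k * k" "k * k < k / 2"
    using assms by auto
  have fits
    unfolding fits_def unfolding aut1_eq[OF assms(1)]
  proof (intro allI, goal_cases)
    case (1 i j)
    show ?case
      using exhaust_2[of i] exhaust_2[of j]
      by (elim disjE; hypsubst;
          auto simp: word_simps iform_pt assms(1) image_Un ball_Un image_image
            closed_segment_eq_real_ivl algebra_simps simp del: replicate_Suc;
          insert square bounds assms(2,3))
        (linarith | (drule multiples, elim conjE, linarith))+
  qed
  then show ?thesis
    by unfold_locales
qed

text \<open>Here \<open>fits\<close> fails: the image of a tile of type 2 contains one that starts
  at \<open>- k * k\<close> relative to the constant, left of the unit interval. Patches repair this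
  below.\<close>

lemma sigma2_tiling:
  fixes k :: real
  assumes "a = - int n - 3" "- 1 < k" "k < 0" "k ^ 2 = a * k - 1"
  shows "dual_tiling (sigma_aut T2 a) 1 k (a - k) k (pt (- 1) a)"
  unfolding aut2_eq[OF assms(1)]
proof (unfold_locales, goal_cases)
  case (9 h i)
  show ?case
    using telescope_parity[of "\<lambda>m. h (pt 0 (- int m))" n] exhaust_2[of i]
    by (elim disjE; hypsubst?;
        simp add: assms(1) sum_2 sum_list_rev_upt word_simps o_def algebra_simps del: replicate_Suc;
        (simp add: minus_int_commute; argo)?)
qed (use assms(2-) arg_cong[OF assms(1), of real_of_int] in
    \<open>simp_all add: det_2 mat_simps abel_simps axis_pt power2_eq_square algebra_simps del: replicate_Suc\<close>)

lemma tau2_tiling: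
  fixes k :: real
  assumes "a = - int n - 3" "- 1 < k" "k < 0" "k ^ 2 = a * k - 1"
  shows "dual_tiling (tau_aut T2 a) (1 + k) k (a - k) k (pt (- 1) (1 + a))"
  unfolding aut2_eq[OF assms(1)]
proof (unfold_locales, goal_cases)
  case (9 h i)
  show ?case
    using shift_parity[of "\<lambda>m. h (pt 0 (- 1 - int m))" "\<lambda>m. h (pt (- 1) (- 2 - int m - int n))" n] exhaust_2[of i]
    by (elim disjE; hypsubst?;
        simp add: assms(1) sum_2 sum_list_rev_upt word_simps o_def algebra_simps del: replicate_Suc;
        (simp add: minus_int_commute; argo)?)
qed (use assms(2-) arg_cong[OF assms(1), of real_of_int] in
    \<open>simp_all add: det_2 mat_simps abel_simps axis_pt power2_eq_square algebra_simps del: replicate_Suc\<close>)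

lemma tau2_fits:
  fixes k :: real
  assumes "a = - int n - 3" "- 1 < k" "k < 0" "k ^ 2 = a * k - 1"
  shows "fitting_tiling (tau_aut T2 a) (1 + k) k (a - k) k (pt (- 1) (1 + a))"
proof -
  interpret dual_tiling "tau_aut T2 a" "1 + k" k "a - k" k "pt (- 1) (1 + a)"
    by (rule tau2_tiling[OF assms])
  have multiples: "k * real m \<le> 0 \<and> k * real n \<le> k * real m + k" if "m < n" for m
    using mult_left_mono_neg[of "real (Suc m)" "real n" k] that assms
    by (auto simp: algebra_simps mult_nonpos_nonneg)
  have square: "k * k = - (k * real n) - 3 * k - 1"
    using assms(4) arg_cong[OF assms(1), of real_of_int] by (simp add: power2_eq_square algebra_simps)
  have bounds: "k * real n \<le> 0" "0 < k * k" "k * k < - k"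
    using mult_strict_right_mono_neg[of "- 1" k k] assms by (auto simp: mult_neg_neg mult_nonpos_nonneg)
  have fits
    unfolding fits_def unfolding aut2_eq[OF assms(1)]
  proof (intro allI, goal_cases)
    case (1 i j)
    show ?case
      using exhaust_2[of i] exhaust_2[of j]
      by (elim disjE; hypsubst;
          auto simp: word_simps iform_pt assms(1) image_Un ball_Un image_image
            closed_segment_eq_real_ivl algebra_simps simp del: replicate_Suc;
          insert square bounds assms(2,3))
        (linarith | (drule multiples, elim conjE, linarith))+
  qed
  then show ?thesis
    by unfold_locales
qed

lemma sigma4_tiling:
  fixes k :: real
  assumes "a = - int n - 1" "0 < k" "k < 1" "k ^ 2 = a * k + 1"
  shows "dual_tiling (sigma_aut T4 a) 1 k (a - k) k (pt 0 a)"
  unfolding aut4_eq[OF assms(1)]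
proof (unfold_locales, goal_cases)
  case (9 h i)
  show ?case
    using telescope_parity[of "\<lambda>m. h (pt 0 (- int m))" n] exhaust_2[of i]
    by (elim disjE; hypsubst?;
        simp add: assms(1) sum_2 sum_list_rev_upt word_simps o_def algebra_simps del: replicate_Suc;
        (simp add: minus_int_commute; argo)?)
qed (use assms(2-) arg_cong[OF assms(1), of real_of_int] in
    \<open>simp_all add: det_2 mat_simps abel_simps axis_pt power2_eq_square algebra_simps del: replicate_Suc\<close>)

lemma sigma4_fits:
  fixes k :: real
  assumes "a = - int n - 1" "0 < k" "k < 1" "k ^ 2 = a * k + 1"
  shows "fitting_tiling (sigma_aut T4 a) 1 k (a - k) k (pt 0 a)"
proof -
  interpret dual_tiling "sigma_aut T4 a" 1 k "a - k" k "pt 0 a"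
    by (rule sigma4_tiling[OF assms])
  have multiples: "0 \<le> k * real m \<and> k * real m + k \<le> k * real n" if "m < n" for m
    using mult_left_mono[of "real (Suc m)" "real n" k] that assms by (auto simp: algebra_simps)
  have square: "k * k = - (k * real n) - k + 1"
    using assms(4) arg_cong[OF assms(1), of real_of_int] by (simp add: power2_eq_square algebra_simps)
  have bounds: "0 \<le> k * real n" "0 < k * k" "k * k < k"
    using assms by auto
  have fits
    unfolding fits_def unfolding aut4_eq[OF assms(1)]
  proof (intro allI, goal_cases)
    case (1 i j)
    show ?case
      using exhaust_2[of i] exhaust_2[of j]
      by (elim disjE; hypsubst;
          auto simp: word_simps iform_pt assms(1) image_Un ball_Un image_image
            closed_segment_eq_real_ivl algebra_simps simp del: replicate_Suc;
          insert square bounds assms(2,3))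
        (linarith | (drule multiples, elim conjE, linarith))+
  qed
  then show ?thesis
    by unfold_locales
qed

lemma tau4_tiling:
  fixes k :: real
  assumes "a = - int n - 1" "0 < k" "k < 1" "k ^ 2 = a * k + 1"
  shows "dual_tiling (tau_aut T4 a) (- 1) k (a - k) k (pt (- 1) (a - 1))"
  unfolding aut4_eq[OF assms(1)]
proof (unfold_locales, goal_cases)
  case (9 h i)
  show ?case
    using telescope_parity[of "\<lambda>m. h (pt 0 (- 1 - int m))" n] exhaust_2[of i]
    by (elim disjE; hypsubst?;
        simp add: assms(1) sum_2 sum_list_rev_upt word_simps o_def algebra_simps del: replicate_Suc;
        (simp add: minus_int_commute; argo)?)
qed (use assms(2-) arg_cong[OF assms(1), of real_of_int] in
    \<open>simp_all add: det_2 mat_simps abel_simps axis_pt power2_eq_square algebra_simps del: replicate_Suc\<close>)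

lemma tau4_fits:
  fixes k :: real
  assumes "a = - int n - 1" "0 < k" "k < 1" "k ^ 2 = a * k + 1"
  shows "fitting_tiling (tau_aut T4 a) (- 1) k (a - k) k (pt (- 1) (a - 1))"
proof -
  interpret dual_tiling "tau_aut T4 a" "- 1" k "a - k" k "pt (- 1) (a - 1)"
    by (rule tau4_tiling[OF assms])
  have multiples: "0 \<le> k * real m \<and> k * real m + k \<le> k * real n" if "m < n" for m
    using mult_left_mono[of "real (Suc m)" "real n" k] that assms by (auto simp: algebra_simps)
  have square: "k * k = - (k * real n) - k + 1"
    using assms(4) arg_cong[OF assms(1), of real_of_int] by (simp add: power2_eq_square algebra_simps)
  have bounds: "0 \<le> k * real n" "0 < k * k" "k * k < k"
    using assms by auto
  have fits
    unfolding fits_def unfolding aut4_eq[OF assms(1)]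
  proof (intro allI, goal_cases)
    case (1 i j)
    show ?case
      using exhaust_2[of i] exhaust_2[of j]
      by (elim disjE; hypsubst;
          auto simp: word_simps iform_pt assms(1) image_Un ball_Un image_image
            closed_segment_eq_real_ivl algebra_simps simp del: replicate_Suc;
          insert square bounds assms(2,3))
        (linarith | (drule multiples, elim conjE, linarith))+
  qed
  then show ?thesis
    by unfold_locales
qed

text \<open>For \<open>T2\<close>, the patches are the images of the tiles under the dual of \<open>delta_aut T2\<close>.\<close>

definition patch2 :: "symb \<Rightarrow> chain" where
  "patch2 = (\<lambda>(x, i). if i = 1 then frag_of (x, 1) else frag_of (x, 2) - frag_of (x + pt 1 0, 1))"

text \<open>This is the dual of \<open>tau_aut T2\<close> with base points transported by the matrix
  of \<open>delta_aut_inv T2\<close>: patches are subdivided the way the tiles of tau are.\<close>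

definition sub_patch2 :: "int \<Rightarrow> nat \<Rightarrow> symb \<Rightarrow> chain" where
  "sub_patch2 a n = (\<lambda>(x, i). let z = (\<lambda>b. matrix_inv (inc_mat (sigma_aut T2 a)) *v (x + b)) in
     if i = 1 then - frag_of (z (pt (- 1) a), 2) - frag_of (z (pt (- 1) (a + 1)), 1)
     else - (\<Sum>m<n + 2. frag_of (z (pt 0 (- int (Suc m))), 2))
          - (\<Sum>m<n + 1. frag_of (z (pt 0 (- int (Suc m))), 1)))"

text \<open>The widths \<open>k\<close> and \<open>1 + k\<close> are the signed tile lengths of tau.
  A patch of type 2 is a unit segment corrected at its end by a tile of length \<open>k\<close>; its
  second base lies 1 away, hence the spread 1.\<close>

lemma sigma2_patch_system:
  fixes k :: real
  assumes a: "a = - int n - 3" and k: "- 1 < k" "k < 0" "k ^ 2 = a * k - 1"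
  shows "dual_tiling.patch_system (sigma_aut T2 a) 1 k k (pt (- 1) a) patch2 (sub_patch2 a n)
    (\<lambda>i. if i = 1 then k else 1 + k) 1"
proof -
  interpret dual_tiling "sigma_aut T2 a" 1 k "a - k" k "pt (- 1) a"
    by (rule sigma2_tiling[OF assms])
  have abel1: "abel (sigma_aut T2 a 1) = pt 0 1"
    by (simp add: aut2_eq[OF a] endo_def abel_simps axis_pt)
  \<comment> \<open>The matrix of sigma sends the first unit vector to the second; this aligns the
    correcting tiles of neighbouring patches.\<close>
  have step: "B *v y + pt 1 0 = B *v (y + pt 0 1)" for y
    using B_abel[of y 1] unfolding abel1 axis_pt by (rule sym)
  have tile1: "dual_tile (sigma_aut T2 a) (x, 1) = - frag_of (B *v (x + pt (- 1) a), 2)" for x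
    unfolding dual_tile_def B_def[symmetric] unfolding aut2_eq[OF a]
    by (simp add: sum_2 bases_replicate' endo_def abel_simps axis_pt a minus_int_commute del: replicate_Suc)
  have tile2: "dual_tile (sigma_aut T2 a) (x, 2) = frag_of (B *v x, 1)
      - (\<Sum>m<n + 3. frag_of (B *v (x + pt 0 (- int (Suc m))), 2))" for x
  proof -
    have "frag_of (B *v (x + pt 0 0), 1) = frag_of (B *v x, 1::2)" by (simp add: zero_pt[symmetric])
    then show ?thesis
      unfolding dual_tile_def B_def[symmetric] unfolding aut2_eq[OF a]
      by (simp add: sum_2 bases_replicate' endo_def abel_simps axis_pt a sum_list_rev_upt o_def sum_negf
          numeral_3_eq_3 algebra_simps del: replicate_Suc)
  qed
  have sub: "sub_patch2 a n (x, i) = (if i = 1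
     then - frag_of (B *v (x + pt (- 1) a), 2) - frag_of (B *v (x + pt (- 1) (a + 1)), 1)
     else - (\<Sum>m<n + 2. frag_of (B *v (x + pt 0 (- int (Suc m))), 2))
          - (\<Sum>m<n + 1. frag_of (B *v (x + pt 0 (- int (Suc m))), 1)))" for x i
    unfolding sub_patch2_def B_def Let_def by simp
  have sub1: "tile_subst (sigma_aut T2 a) (patch2 (x, 1)) = frag_extend patch2 (sub_patch2 a n (x, 1))" for x
    by (simp add: tile_subst_eq tile1 sub patch2_def frag_extend_diff frag_extend_minus step add.assoc)
  have sub2: "tile_subst (sigma_aut T2 a) (patch2 (x, 2)) = frag_extend patch2 (sub_patch2 a n (x, 2))" for x
  proof -
    let ?Z = "\<lambda>m j. frag_of (B *v (x + pt 0 (- int m)), j :: 2)"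
    \<comment> \<open>The tiles of type 1 telescope, leaving only the one with index 0.\<close>
    have "frag_extend patch2 (sub_patch2 a n (x, 2))
       = - (\<Sum>m<n + 2. ?Z (Suc m) 2 - ?Z m 1) - (\<Sum>m<n + 1. ?Z (Suc m) 1)"
      by (simp add: sub frag_extend_diff frag_extend_minus frag_extend_sum o_def patch2_def step add.assoc
         del: sum.lessThan_Suc)
    also have "\<dots> = (\<Sum>m<Suc (n + 1). ?Z m 1) - (\<Sum>m<n + 1. ?Z (Suc m) 1) - (\<Sum>m<n + 2. ?Z (Suc m) 2)"
      by (simp add: sum_subtractf del: sum.lessThan_Suc)
    also have "\<dots> = ?Z 0 1 - (\<Sum>m<n + 2. ?Z (Suc m) 2)"
      unfolding sum.lessThan_Suc_shift by simp
    finally have E: "frag_extend patch2 (sub_patch2 a n (x, 2)) = ?Z 0 1 - (\<Sum>m<n + 2. ?Z (Suc m) 2)" .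
    have "tile_subst (sigma_aut T2 a) (patch2 (x, 2))
       = frag_of (B *v x, 1) - (\<Sum>m<Suc (n + 2). ?Z (Suc m) 2) + frag_of (B *v (x + pt 1 0 + pt (- 1) a), 2)"
      by (simp add: tile_subst_eq tile1 tile2 patch2_def frag_extend_diff eval_nat_numeral del: sum.lessThan_Suc)
    \<comment> \<open>Since \<open>a\<close> is \<open>- (n + 3)\<close>, this tile cancels the last
      summand of the sum over \<open>n + 3\<close> terms.\<close>
    also have "B *v (x + pt 1 0 + pt (- 1) a) = B *v (x + pt 0 (- int (Suc (n + 2))))"
      by (simp add: add.assoc a minus_int_commute)
    also have "frag_of (B *v x, 1) = ?Z 0 1" by (simp add: zero_pt[symmetric])
    finally show ?thesis unfolding E by simp
  qed
  have k2: "k * k = - (k * real n) - 3 * k - 1"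
    using k(3) by (simp add: a power2_eq_square algebra_simps)
  have k3: "k * k < - k" "0 < k * k"
    using mult_strict_right_mono_neg[of "- 1" k k] k by (auto simp: mult_neg_neg)
  have c: "iform (pt (- 1) a) = k * k"
    by (simp add: iform_pt k2 a algebra_simps)
  show ?thesis
    unfolding patch_system_def
  proof (intro conjI allI impI)
    fix x i y j
    assume "(y, j) \<in> Poly_Mapping.keys (patch2 (x, i))"
    then have "y = x \<or> y = x + pt 1 0"
      using keys_diff[of "frag_of (x, 2)" "frag_of (x + pt 1 0, 1)"] by (auto simp: patch2_def split: if_splits)
    then show "\<bar>iform y - iform x\<bar> \<le> 1"
      by (auto simp: iform_add iform_pt)
  next
    fix x and i :: 2
    show "tile_subst (sigma_aut T2 a) (patch2 (x, i)) = frag_extend patch2 (sub_patch2 a n (x, i))"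
      using exhaust_2[of i] sub1 sub2 by blast
  next
    fix x i y j
    assume y: "(y, j) \<in> Poly_Mapping.keys (sub_patch2 a n (x, i))"
    let ?w = "\<lambda>i :: 2. if i = 1 then k else 1 + k"
    show "\<exists>b. y = B *v (x + b) \<and> iform b - iform (pt (- 1) a) \<in> closed_segment 0 (?w i)
           \<and> iform b + k * ?w j - iform (pt (- 1) a) \<in> closed_segment 0 (?w i)"
    proof (cases "i = 1")
      case True
      then have "(y = B *v (x + pt (- 1) a) \<and> j = 2) \<or> (y = B *v (x + pt (- 1) (a + 1)) \<and> j = 1)"
        using y keys_diff[of "- frag_of (B *v (x + pt (- 1) a), 2::2)" "frag_of (B *v (x + pt (- 1) (a + 1)), 1)"]
        by (auto simp: sub)
      then show ?thesis
      proof (elim disjE conjE)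
        assume "y = B *v (x + pt (- 1) a)" "j = 2"
        then show ?thesis
          using True k k3 by (intro exI[of _ "pt (- 1) a"]) (auto simp: closed_segment_eq_real_ivl algebra_simps)
      next
        assume "y = B *v (x + pt (- 1) (a + 1))" "j = 1"
        moreover have "iform (pt (- 1) (a + 1)) = k * k + k"
          using c by (simp add: iform_pt algebra_simps)
        ultimately show ?thesis
          using True k k3 by (intro exI[of _ "pt (- 1) (a + 1)"]) (auto simp: closed_segment_eq_real_ivl c)
      qed
    next
      case False
      then have "\<exists>m. y = B *v (x + pt 0 (- int (Suc m))) \<and> (j = 2 \<and> m < n + 2 \<or> j = 1 \<and> m < n + 1)"
        using y keys_diff[of "- (\<Sum>m<n + 2. frag_of (B *v (x + pt 0 (- int (Suc m))), 2::2))"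
           "\<Sum>m<n + 1. frag_of (B *v (x + pt 0 (- int (Suc m))), 1::2)"]
          keys_sum[of "\<lambda>m. frag_of (B *v (x + pt 0 (- int (Suc m))), 2::2)" "{..<n + 2}"]
          keys_sum[of "\<lambda>m. frag_of (B *v (x + pt 0 (- int (Suc m))), 1::2)" "{..<n + 1}"]
        unfolding sub if_not_P[OF False] keys_minus by fastforce
      then obtain m where m: "y = B *v (x + pt 0 (- int (Suc m)))" "j = 2 \<and> m < n + 2 \<or> j = 1 \<and> m < n + 1"
        by blast
      have lo: "k * real m \<le> 0" using k by (simp add: mult_nonpos_nonneg)
      have hi: "j = 2 \<Longrightarrow> k * (real n + 1) \<le> k * real m" "j = 1 \<Longrightarrow> k * real n \<le> k * real m"
        using m(2) k by (auto intro!: mult_left_mono_neg)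
      have b: "iform (pt 0 (- int (Suc m))) = - k - k * real m"
        by (simp add: iform_pt algebra_simps)
      have w: "?w i = 1 + k" "j = 2 \<Longrightarrow> k * ?w j = k + k * k" "j = 1 \<Longrightarrow> k * ?w j = k * k"
        using False by (simp_all add: algebra_simps)
      have seg: "r \<in> closed_segment 0 (1 + k) \<longleftrightarrow> 0 \<le> r \<and> r \<le> 1 + k" for r
        using k by (auto simp: closed_segment_eq_real_ivl)
      have hi2: "j = 2 \<Longrightarrow> k * real n + k \<le> k * real m"
        using hi(1) by (simp add: algebra_simps)
      show ?thesis
        unfolding w(1) seg c
      proof (intro exI[of _ "pt 0 (- int (Suc m))"] conjI)
        show "y = B *v (x + pt 0 (- int (Suc m)))" by (rule m(1))
        have "(k * ?w j = k * k \<and> k * real n \<le> k * real m) \<or>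
            (k * ?w j = k + k * k \<and> k * real n + k \<le> k * real m)"
          using exhaust_2[of j] hi(2) hi2 w(2,3) by blast
        then show "0 \<le> iform (pt 0 (- int (Suc m))) - k * k"
          "iform (pt 0 (- int (Suc m))) - k * k \<le> 1 + k"
          "0 \<le> iform (pt 0 (- int (Suc m))) + k * ?w j - k * k"
          "iform (pt 0 (- int (Suc m))) + k * ?w j - k * k \<le> 1 + k"
          using k(1,2) k2 k3 lo unfolding b by linarith+
      qed
    qed
  qed
qed

section \<open>The set equations\<close>

lemma matrix_inv_real_eqI:
  fixes A :: "real ^ 'n ^ 'n"
  assumes "A ** A' = mat 1"
  shows "matrix_inv A = A'"
proof -
  have A': "A' ** A = mat 1" using assms by (simp add: matrix_left_right_inverse)
  then have "A ** matrix_inv A = mat 1 \<and> matrix_inv A ** A = mat 1"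
    unfolding matrix_inv_def
    by (rule someI[of "\<lambda>A'. A ** A' = mat 1 \<and> A' ** A = mat 1", OF conjI, OF assms])
  then have "A' ** (A ** matrix_inv A) = A'" by simp
  then show ?thesis by (simp add: matrix_mul_assoc A')
qed

lemma matrix_inv_delta: "matrix_inv (real_mat (delta_aut t)) = real_mat (delta_aut_inv t)"
  by (rule matrix_inv_real_eqI)
    (cases t; simp add: vec_eq_iff forall_2 matrix_matrix_mult_def sum_2 mat_simps abel_simps axis_pt mat_def)

text \<open>Isolates what is asserted for one index, so that the two indices can be treated by the
  shape of their unions.\<close>

definition parts_claim :: "family \<Rightarrow> int \<Rightarrow> 2 \<Rightarrow> bool" where
  "parts_claim t a i \<longleftrightarrow>
        X_sigma_part t a i = (\<Union>j. \<Union>k\<in>occ (delta_aut_inv t j) (eps_letter t i). piece t a j k)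
      \<and> X_sigma_part' t a i = (\<Union>j. \<Union>k\<in>occ (delta_aut_inv t j) (eps_letter t i). piece' t a j k)
      \<and> (\<forall>j j' k k'. k \<in> occ (delta_aut_inv t j) (eps_letter t i) \<longrightarrow>
            k' \<in> occ (delta_aut_inv t j') (eps_letter t i) \<longrightarrow> (j, k) \<noteq> (j', k') \<longrightarrow>
            line_null (contracting_line (sigma_aut t a)) (piece t a j k \<inter> piece t a j' k')
          \<and> line_null (contracting_line (sigma_aut t a)) (piece' t a j k \<inter> piece' t a j' k'))
      \<and> is_interval_in (contracting_line (sigma_aut t a)) (X_sigma_part t a i)
      \<and> is_interval_in (contracting_line (sigma_aut t a)) (X_sigma_part' t a i)"

lemma UN_2: "(\<Union>j::2. A j) = A 1 \<union> A 2"
  by (auto simp: UNIV_2)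

lemma occ_Nil: "occ [] l = {}"
  by (simp add: occ_def)

lemma parts_claim_single:
  assumes occ: "\<And>j. occ (delta_aut_inv t j) (eps_letter t i) = (if j = j0 then {k0} else {})"
    and "X_sigma_part t a i = piece t a j0 k0" "X_sigma_part' t a i = piece' t a j0 k0"
    and "is_interval_in (contracting_line (sigma_aut t a)) (X_sigma_part t a i)"
    and "is_interval_in (contracting_line (sigma_aut t a)) (X_sigma_part' t a i)"
  shows "parts_claim t a i"
  unfolding parts_claim_def occ using assms(2-) by (auto split: if_splits)

lemma parts_claim_double:
  assumes occ: "occ (delta_aut_inv t 1) (eps_letter t i) = {k1}" "occ (delta_aut_inv t 2) (eps_letter t i) = {k2}"
    and un: "X_sigma_part t a i = piece t a 1 k1 \<union> piece t a 2 k2" "X_sigma_part' t a i = piece' t a 1 k1 \<union> piece' t a 2 k2"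
    and null: "line_null (contracting_line (sigma_aut t a)) (piece t a 1 k1 \<inter> piece t a 2 k2)"
      "line_null (contracting_line (sigma_aut t a)) (piece' t a 1 k1 \<inter> piece' t a 2 k2)"
    and int: "is_interval_in (contracting_line (sigma_aut t a)) (X_sigma_part t a i)"
      "is_interval_in (contracting_line (sigma_aut t a)) (X_sigma_part' t a i)"
  shows "parts_claim t a i"
proof -
  have occ': "(k \<in> occ (delta_aut_inv t j) (eps_letter t i)) \<longleftrightarrow> (j = 1 \<and> k = k1 \<or> j = 2 \<and> k = k2)" for j k
    using exhaust_2[of j] occ by auto
  show ?thesis
    unfolding parts_claim_def occ' using un null int by (auto simp: UN_2 occ Int_commute)
qed

text \<open>The intermediate value theorem; the product condition covers both directions of the sign
  change and excludes the end points.\<close>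

lemma polynomial_root:
  fixes a c l h :: real
  assumes "(l ^ 2 - a * l + c) * (h ^ 2 - a * h + c) < 0" "l < h"
  shows "\<exists>k. l < k \<and> k < h \<and> k ^ 2 = a * k - c"
proof -
  let ?f = "\<lambda>x. x ^ 2 - a * x + c"
  have cont: "continuous_on {l..h} ?f" "continuous_on {l..h} (\<lambda>x. - ?f x)"
    by (intro continuous_intros)+
  have "\<exists>x\<ge>l. x \<le> h \<and> ?f x = 0"
  proof (cases "?f l < 0")
    case True
    then have "?f h > 0" using assms(1) by (simp add: mult_less_0_iff)
    then show ?thesis using IVT'[of ?f l 0 h] True assms(2) cont by simp
  next
    case False
    then have "?f l > 0" "?f h < 0" using assms(1) by (auto simp: mult_less_0_iff)
    then show ?thesis using IVT2'[of ?f h 0 l] assms(2) cont by auto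
  qed
  then obtain x where x: "l \<le> x" "x \<le> h" "?f x = 0" by blast
  moreover have "x \<noteq> l" "x \<noteq> h" using x assms(1) by auto
  ultimately show ?thesis by (intro exI[of _ x]) auto
qed

text \<open>Both substitutions share their eigenvalues and, through \<open>form_conjugate\<close>,
  their coordinate. For sigma only \<open>dual_tiling\<close> is required, since \<open>fits\<close>
  fails in the family \<open>T2\<close>.\<close>

locale conjugate_tilings =
  sigma: dual_tiling "sigma_aut t a" 1 k \<kappa> k c\<^sub>1 + tau: fitting_tiling "tau_aut t a" \<alpha> k \<kappa> k c\<^sub>2
  for t :: family and a :: int and k \<kappa> \<alpha> :: real and c\<^sub>1 c\<^sub>2 +
  assumes conjugate: "real_mat (sigma_aut t a) ** real_mat (delta_aut_inv t)
      = real_mat (delta_aut_inv t) ** real_mat (tau_aut t a)"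
    and form_conjugate: "\<And>v. sigma.form (real_mat (delta_aut_inv t) *v v) = tau.form v"
begin

lemma tau_tile:
  "rauzy (tau_aut t a) (frag_of (x, i))
     = tau.arc (tau.iform x + tau.offset) (tau.iform x + tau.iform (axis (other i) 1) + tau.offset)"
  by (rule tau.rauzy_tile)
    (use exhaust_2[of i] tau.alpha sigma.nonzero in \<open>auto simp: axis_pt tau.iform_pt\<close>)

lemma piece_eq:
  "piece t a j m = sigma.arc
     (tau.iform (axis j 1) + tau.offset - sigma.iform (abel (take m (delta_aut_inv t j))))
     (tau.iform (axis j 1) + tau.iform (axis (other j) 1) + tau.offset
        - sigma.iform (abel (take m (delta_aut_inv t j))))"
  unfolding piece_def X_tau_def seed.simps tau_tile matrix_inv_delta sigma.iform_def
  by (rule sigma.affine_image_arc(2)[OF tau.contracting_form_axioms conjugate form_conjugate])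

lemma piece'_eq:
  "piece' t a j m = sigma.arc
     (tau.offset + sigma.iform (abel (drop (Suc m) (delta_aut_inv t j))))
     (tau.iform (axis (other j) 1) + tau.offset + sigma.iform (abel (drop (Suc m) (delta_aut_inv t j))))"
proof -
  have "X_tau' t a j = tau.arc tau.offset (tau.iform (axis (other j) 1) + tau.offset)"
    by (simp add: X_tau'_def tau_tile zero_pt tau.iform_pt)
  then show ?thesis
    unfolding piece'_def matrix_inv_delta sigma.iform_def
    using sigma.affine_image_arc(1)[OF tau.contracting_form_axioms conjugate form_conjugate] by simp
qed

end

lemma conclusion_T1:
  assumes "a \<ge> 3"
  shows "parts_claim T1 a 1 \<and> parts_claim T1 a 2
    \<and> is_interval_in (contracting_line (sigma_aut T1 a)) (X_sigma T1 a)
    \<and> is_interval_in (contracting_line (sigma_aut T1 a)) (X_sigma' T1 a)"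
proof -
  define n where "n = nat (a - 3)"
  have a: "a = int n + 3" using assms by (simp add: n_def)
  have "\<exists>k::real. 0 < k \<and> k < 1 / 2 \<and> k ^ 2 = a * k - 1"
    using assms by (intro polynomial_root) (auto simp: power2_eq_square)
  then obtain k :: real where k: "0 < k" "k < 1 / 2" "k ^ 2 = a * k - 1" by blast
  interpret sigma: fitting_tiling "sigma_aut T1 a" 1 k "a - k" k "pt (- 1) 2"
    by (rule sigma1_fits[OF a k])
  interpret tau: fitting_tiling "tau_aut T1 a" "k - 1" k "a - k" k "pt 1 (a - 1)"
    by (rule tau1_fits[OF a k])
  interpret conjugate_tilings T1 a k "a - k" "k - 1" "pt (- 1) 2" "pt 1 (a - 1)"
  proof unfold_locales
    show "real_mat (sigma_aut T1 a) ** real_mat (delta_aut_inv T1)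
        = real_mat (delta_aut_inv T1) ** real_mat (tau_aut T1 a)"
      unfolding aut1_eq[OF a]
      by (simp add: vec_eq_iff forall_2 matrix_matrix_mult_def sum_2 mat_simps abel_simps axis_pt del: replicate_Suc)
    show "sigma.form (real_mat (delta_aut_inv T1) *v v) = tau.form v" for v
      by (simp add: sigma.form_def tau.form_def matrix_vector_mult_def sum_2 mat_simps abel_simps axis_pt algebra_simps)
  qed
  let ?s = sigma.offset
  \<comment> \<open>The offsets are \<open>k\<^sup>2 / (1 - k)\<close> for tau and
    \<open>(2 * k - 1) / (1 - k)\<close> for sigma, by the equation for \<open>k\<close>.\<close>
  have off: "tau.offset = ?s + 1 - k"
    using k by (simp add: sigma.offset_def tau.offset_def sigma.iform_pt tau.iform_pt field_simps power2_eq_square)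
  note tile_simps = axis_pt zero_pt sigma.iform_pt tau.iform_pt
  have tile: "rauzy (sigma_aut T1 a) (frag_of (pt p q, 1)) = sigma.arc (p + k * q + ?s) (p + k * q + k + ?s)"
      "rauzy (sigma_aut T1 a) (frag_of (pt p q, 2)) = sigma.arc (p + k * q + ?s) (p + k * q + 1 + ?s)" for p q
    using sigma.rauzy_tile[of 1 "pt p q"] sigma.rauzy_tile[of 2 "pt p q"] k by (simp_all add: tile_simps)
  have parts: "X_sigma_part T1 a 1 = sigma.arc ?s (k + ?s)"
    "X_sigma_part T1 a 2 = sigma.arc (k + ?s) (1 + (k + ?s))"
    "X_sigma_part' T1 a 1 = sigma.arc (1 + ?s) (1 + (k + ?s))"
    "X_sigma_part' T1 a 2 = sigma.arc ?s (1 + ?s)"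
    by (simp_all add: X_sigma_part_def X_sigma_part'_def eps_letter_def axis_pt zero_pt tile add_ac)
  \<comment> \<open>Arcs from tiles of type 2 run downwards, because their signed length
    \<open>k - 1\<close> is negative.\<close>
  have pieces: "piece T1 a 1 0 = sigma.arc ?s (k + ?s)"
    "piece T1 a 1 1 = sigma.arc (1 + ?s) (1 + (k + ?s))"
    "piece T1 a 2 0 = sigma.arc (1 + ?s) (k + ?s)"
    "piece' T1 a 1 0 = sigma.arc (1 + ?s) (1 + (k + ?s))"
    "piece' T1 a 1 1 = sigma.arc (1 + ?s - k) (1 + ?s)"
    "piece' T1 a 2 0 = sigma.arc (1 + ?s - k) ?s"
    by (simp_all add: piece_eq piece'_eq tile_simps endo_def abel_simps off algebra_simps)
  have "parts_claim T1 a 1"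
  proof (rule parts_claim_single[where ?j0.0 = 1 and ?k0.0 = 0])
    fix j show "occ (delta_aut_inv T1 j) (eps_letter T1 1) = (if j = 1 then {0} else {})"
      using exhaust_2[of j] by (auto simp: occ_Cons occ_Nil endo_def eps_letter_def)
  qed (use k in \<open>simp_all add: parts pieces sigma.is_interval_arc\<close>)
  moreover have "parts_claim T1 a 2"
  proof (rule parts_claim_double)
    show "occ (delta_aut_inv T1 1) (eps_letter T1 2) = {1}" "occ (delta_aut_inv T1 2) (eps_letter T1 2) = {0}"
      by (auto simp: occ_Cons occ_Nil endo_def eps_letter_def)
    show "X_sigma_part T1 a 2 = piece T1 a 1 1 \<union> piece T1 a 2 0"
      "X_sigma_part' T1 a 2 = piece' T1 a 1 1 \<union> piece' T1 a 2 0"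
      unfolding parts pieces
      by (rule sigma.arc_Un_eq[symmetric]; use k in \<open>auto simp: closed_segment_eq_real_ivl\<close>)+
    show "line_null (contracting_line (sigma_aut T1 a)) (piece T1 a 1 1 \<inter> piece T1 a 2 0)"
      unfolding pieces
      by (rule sigma.line_null_arc_Int[where m = "1 + ?s"]) (use k in \<open>auto simp: closed_segment_eq_real_ivl\<close>)
    show "line_null (contracting_line (sigma_aut T1 a)) (piece' T1 a 1 1 \<inter> piece' T1 a 2 0)"
      unfolding pieces
      by (rule sigma.line_null_arc_Int[where m = "1 + ?s - k"]) (use k in \<open>auto simp: closed_segment_eq_real_ivl\<close>)
  qed (use k in \<open>simp_all add: parts sigma.is_interval_arc\<close>)
  moreover have "X_sigma T1 a = sigma.arc ?s (1 + k + ?s)"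
  proof -
    have "rauzy (sigma_aut T1 a) (frag_of (pt 0 0, 1) + frag_of (pt 0 1, 2))
        = sigma.arc (sigma.iform (pt 0 0) + ?s) (sigma.iform (pt 1 1) + ?s)"
      by (rule sigma.rauzy_two_tiles)
        (use k in \<open>auto simp: ends_at_def bd_add bd_of tile_simps closed_segment_eq_real_ivl\<close>)
    then show ?thesis by (simp add: X_sigma_def eps_letter_def tile_simps)
  qed
  moreover have "X_sigma' T1 a = sigma.arc ?s (1 + k + ?s)"
  proof -
    have "rauzy (sigma_aut T1 a) (frag_of (pt 1 0, 1) + frag_of (pt 0 0, 2))
        = sigma.arc (sigma.iform (pt 0 0) + ?s) (sigma.iform (pt 1 1) + ?s)"
      by (rule sigma.rauzy_two_tiles)
        (use k in \<open>auto simp: ends_at_def bd_add bd_of tile_simps closed_segment_eq_real_ivl\<close>)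
    then show ?thesis by (simp add: X_sigma'_def eps_letter_def tile_simps)
  qed
  ultimately show ?thesis
    using k by (simp add: sigma.is_interval_arc)
qed

lemma keys_frag_of_add: "Poly_Mapping.keys (frag_of s + g) \<subseteq> insert s (Poly_Mapping.keys g)"
  using keys_add[of "frag_of s" g] by auto

lemma conclusion_T2:
  assumes "a \<le> - 3"
  shows "parts_claim T2 a 1 \<and> parts_claim T2 a 2
    \<and> is_interval_in (contracting_line (sigma_aut T2 a)) (X_sigma T2 a)
    \<and> is_interval_in (contracting_line (sigma_aut T2 a)) (X_sigma' T2 a)"
proof -
  define n where "n = nat (- a - 3)"
  have a: "a = - int n - 3" using assms by (simp add: n_def)
  have "\<exists>k::real. - 1 < k \<and> k < 0 \<and> k ^ 2 = a * k - 1"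
    using assms by (intro polynomial_root) (auto simp: power2_eq_square)
  then obtain k :: real where k: "- 1 < k" "k < 0" "k ^ 2 = a * k - 1" by blast
  interpret sigma: dual_tiling "sigma_aut T2 a" 1 k "a - k" k "pt (- 1) a"
    by (rule sigma2_tiling[OF a k])
  interpret tau: fitting_tiling "tau_aut T2 a" "1 + k" k "a - k" k "pt (- 1) (1 + a)"
    by (rule tau2_fits[OF a k])
  interpret conjugate_tilings T2 a k "a - k" "1 + k" "pt (- 1) a" "pt (- 1) (1 + a)"
  proof unfold_locales
    show "real_mat (sigma_aut T2 a) ** real_mat (delta_aut_inv T2)
        = real_mat (delta_aut_inv T2) ** real_mat (tau_aut T2 a)"
      unfolding aut2_eq[OF a]
      by (simp add: vec_eq_iff forall_2 matrix_matrix_mult_def sum_2 mat_simps abel_simps axis_pt del: replicate_Suc)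
    show "sigma.form (real_mat (delta_aut_inv T2) *v v) = tau.form v" for v
      by (simp add: sigma.form_def tau.form_def matrix_vector_mult_def sum_2 mat_simps abel_simps axis_pt algebra_simps)
  qed
  let ?s = sigma.offset
  have off: "tau.offset = ?s"
    using k by (simp add: sigma.offset_def tau.offset_def sigma.iform_pt tau.iform_pt field_simps power2_eq_square)
  note tile_simps = axis_pt zero_pt sigma.iform_pt tau.iform_pt
  have patches: "rauzy (sigma_aut T2 a) g = sigma.arc (sigma.iform p + ?s) (sigma.iform q + ?s)"
    if "g = frag_extend patch2 f" "ends_at p q g" "sigma.iform p \<noteq> sigma.iform q"
      "\<And>x i. (x, i) \<in> Poly_Mapping.keys f \<Longrightarrow>
          sigma.iform x \<in> closed_segment (sigma.iform p) (sigma.iform q)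
        \<and> sigma.iform x + (if i = 1 then k else 1 + k) \<in> closed_segment (sigma.iform p) (sigma.iform q)"
    for f g p q
    unfolding that(1)
  proof (rule sigma.rauzy_eq[OF sigma2_patch_system[OF a k]])
    show "sigma.inside (\<lambda>i. if i = 1 then k else 1 + k) 0 p q f"
      unfolding sigma.inside_def sigma.end_at_0 using that(4) by fastforce
  qed (use that in auto)
  have patch_1: "frag_of (x, 1) = frag_extend patch2 (frag_of (x, 1))" for x
    by (simp add: patch2_def)
  \<comment> \<open>Adding back the correcting tile expresses a single tile by patches; both patches
    project into the unit interval from \<open>x\<close>.\<close>
  have patch_2: "frag_of (x, 2) = frag_extend patch2 (frag_of (x, 2) + frag_of (x + pt 1 0, 1))" for x
    by (simp add: patch2_def frag_extend_add)
  have keys_2: "s \<in> Poly_Mapping.keys (frag_of u + frag_of v) \<Longrightarrow> s = u \<or> s = v" for s u v :: symb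
    using keys_frag_of_add[of u "frag_of v"] by auto
  have keys_3: "s \<in> Poly_Mapping.keys (frag_of u + (frag_of v + frag_of w)) \<Longrightarrow> s = u \<or> s = v \<or> s = w"
    for s u v w :: symb
    using keys_frag_of_add[of u "frag_of v + frag_of w"] keys_2[of s v w] by auto
  have tile_1: "rauzy (sigma_aut T2 a) (frag_of (pt p q, 1)) = sigma.arc (p + k * q + ?s) (p + k * q + k + ?s)" for p q
  proof -
    have "rauzy (sigma_aut T2 a) (frag_of (pt p q, 1))
        = sigma.arc (sigma.iform (pt p q) + ?s) (sigma.iform (pt p (q + 1)) + ?s)"
      by (rule patches[OF patch_1]) (use k in \<open>auto simp: ends_at_def bd_of tile_simps algebra_simps\<close>)
    then show ?thesis by (simp add: tile_simps algebra_simps)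
  qed
  have tile_2: "rauzy (sigma_aut T2 a) (frag_of (pt p q, 2)) = sigma.arc (p + k * q + ?s) (p + k * q + 1 + ?s)" for p q
  proof -
    have "rauzy (sigma_aut T2 a) (frag_of (pt p q, 2))
        = sigma.arc (sigma.iform (pt p q) + ?s) (sigma.iform (pt (p + 1) q) + ?s)"
      by (rule patches[OF patch_2])
        (use k in \<open>auto simp: ends_at_def bd_of tile_simps closed_segment_eq_real_ivl algebra_simps dest!: keys_2\<close>)
    then show ?thesis by (simp add: tile_simps algebra_simps)
  qed
  have parts: "X_sigma_part T2 a 1 = sigma.arc (1 + ?s) (1 + (k + ?s))"
    "X_sigma_part T2 a 2 = sigma.arc (k + ?s) (1 + (k + ?s))"
    "X_sigma_part' T2 a 1 = sigma.arc ?s (k + ?s)"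
    "X_sigma_part' T2 a 2 = sigma.arc ?s (1 + ?s)"
    by (simp_all add: X_sigma_part_def X_sigma_part'_def eps_letter_def axis_pt zero_pt tile_1 tile_2 add_ac)
  have pieces: "piece T2 a 1 1 = sigma.arc (1 + ?s) (1 + (k + ?s))"
    "piece T2 a 1 0 = sigma.arc (1 + (k + ?s)) (1 + (?s + k * 2))"
    "piece T2 a 2 0 = sigma.arc (k + ?s) (1 + (?s + k * 2))"
    "piece' T2 a 1 1 = sigma.arc ?s (k + ?s)"
    "piece' T2 a 1 0 = sigma.arc (1 + ?s) (1 + (k + ?s))"
    "piece' T2 a 2 0 = sigma.arc ?s (1 + (k + ?s))"
    by (simp_all add: piece_eq piece'_eq tile_simps endo_def abel_simps off algebra_simps)
  have "parts_claim T2 a 1"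
  proof (rule parts_claim_single[where ?j0.0 = 1 and ?k0.0 = 1])
    fix j show "occ (delta_aut_inv T2 j) (eps_letter T2 1) = (if j = 1 then {1} else {})"
      using exhaust_2[of j] by (auto simp: occ_Cons occ_Nil endo_def eps_letter_def)
  qed (use k in \<open>simp_all add: parts pieces[unfolded One_nat_def] sigma.is_interval_arc\<close>)
  moreover have "parts_claim T2 a 2"
  proof (rule parts_claim_double)
    show "occ (delta_aut_inv T2 1) (eps_letter T2 2) = {0}" "occ (delta_aut_inv T2 2) (eps_letter T2 2) = {0}"
      by (auto simp: occ_Cons occ_Nil endo_def eps_letter_def)
    show "X_sigma_part T2 a 2 = piece T2 a 1 0 \<union> piece T2 a 2 0"
      "X_sigma_part' T2 a 2 = piece' T2 a 1 0 \<union> piece' T2 a 2 0"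
      unfolding parts pieces
      by (rule sigma.arc_Un_eq[symmetric]; use k in \<open>auto simp: closed_segment_eq_real_ivl\<close>)+
    show "line_null (contracting_line (sigma_aut T2 a)) (piece T2 a 1 0 \<inter> piece T2 a 2 0)"
      unfolding pieces
      by (rule sigma.line_null_arc_Int[where m = "1 + (?s + k * 2)"]) (use k in \<open>auto simp: closed_segment_eq_real_ivl\<close>)
    show "line_null (contracting_line (sigma_aut T2 a)) (piece' T2 a 1 0 \<inter> piece' T2 a 2 0)"
      unfolding pieces
      by (rule sigma.line_null_arc_Int[where m = "1 + (k + ?s)"]) (use k in \<open>auto simp: closed_segment_eq_real_ivl\<close>)
  qed (use k in \<open>simp_all add: parts sigma.is_interval_arc\<close>)
  moreover have "X_sigma T2 a = sigma.arc (k + ?s) (1 + ?s)"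
  proof -
    \<comment> \<open>Both tiles end at \<open>pt 1 1\<close>. Modulo 2 they form a path between the
      two unit vectors, although equal signs do not orient it consistently.\<close>
    have "frag_of (pt 1 0, 1) + frag_of (pt 0 1, 2)
        = frag_extend patch2 (frag_of (pt 1 0, 1) + (frag_of (pt 0 1, 2) + frag_of (pt 1 1, 1)))"
      by (simp add: patch2_def frag_extend_add)
    then have "rauzy (sigma_aut T2 a) (frag_of (pt 1 0, 1) + frag_of (pt 0 1, 2))
        = sigma.arc (sigma.iform (pt 0 1) + ?s) (sigma.iform (pt 1 0) + ?s)"
      by (rule patches)
        (use k in \<open>auto simp: ends_at_def bd_add bd_of tile_simps closed_segment_eq_real_ivl dest!: keys_3\<close>)
    then show ?thesis by (simp add: X_sigma_def eps_letter_def tile_simps)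
  qed
  moreover have "X_sigma' T2 a = sigma.arc (k + ?s) (1 + ?s)"
  proof -
    have "frag_of (pt 0 0, 1) + frag_of (pt 0 0, 2)
        = frag_extend patch2 (frag_of (pt 0 0, 1) + (frag_of (pt 0 0, 2) + frag_of (pt 1 0, 1)))"
      by (simp add: patch2_def frag_extend_add)
    then have "rauzy (sigma_aut T2 a) (frag_of (pt 0 0, 1) + frag_of (pt 0 0, 2))
        = sigma.arc (sigma.iform (pt 0 1) + ?s) (sigma.iform (pt 1 0) + ?s)"
      by (rule patches)
        (use k in \<open>auto simp: ends_at_def bd_add bd_of tile_simps closed_segment_eq_real_ivl dest!: keys_3\<close>)
    then show ?thesis by (simp add: X_sigma'_def eps_letter_def tile_simps)
  qed
  ultimately show ?thesis
    using k by (simp add: sigma.is_interval_arc)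
qed

lemma conclusion_T4:
  assumes "a \<le> - 1"
  shows "parts_claim T4 a 1 \<and> parts_claim T4 a 2
    \<and> is_interval_in (contracting_line (sigma_aut T4 a)) (X_sigma T4 a)
    \<and> is_interval_in (contracting_line (sigma_aut T4 a)) (X_sigma' T4 a)"
proof -
  define n where "n = nat (- a - 1)"
  have a: "a = - int n - 1" using assms by (simp add: n_def)
  have "\<exists>k::real. 0 < k \<and> k < 1 \<and> k ^ 2 = a * k - - 1"
    using assms by (intro polynomial_root) (auto simp: power2_eq_square)
  then obtain k :: real where k: "0 < k" "k < 1" "k ^ 2 = a * k + 1" by auto
  interpret sigma: fitting_tiling "sigma_aut T4 a" 1 k "a - k" k "pt 0 a"
    by (rule sigma4_fits[OF a k])
  interpret tau: fitting_tiling "tau_aut T4 a" "- 1" k "a - k" k "pt (- 1) (a - 1)"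
    by (rule tau4_fits[OF a k])
  interpret conjugate_tilings T4 a k "a - k" "- 1" "pt 0 a" "pt (- 1) (a - 1)"
  proof unfold_locales
    show "real_mat (sigma_aut T4 a) ** real_mat (delta_aut_inv T4)
        = real_mat (delta_aut_inv T4) ** real_mat (tau_aut T4 a)"
      unfolding aut4_eq[OF a]
      by (simp add: vec_eq_iff forall_2 matrix_matrix_mult_def sum_2 mat_simps abel_simps axis_pt del: replicate_Suc)
    show "sigma.form (real_mat (delta_aut_inv T4) *v v) = tau.form v" for v
      by (simp add: sigma.form_def tau.form_def matrix_vector_mult_def sum_2 mat_simps abel_simps axis_pt algebra_simps)
  qed
  let ?s = sigma.offset
  \<comment> \<open>The offsets reduce to \<open>- k\<close> for tau and \<open>- (1 + k)\<close>
    for sigma.\<close>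
  have off: "tau.offset = 1 + ?s"
    using k by (simp add: sigma.offset_def tau.offset_def sigma.iform_pt tau.iform_pt field_simps power2_eq_square)
  note tile_simps = axis_pt zero_pt sigma.iform_pt tau.iform_pt
  have tile: "rauzy (sigma_aut T4 a) (frag_of (pt p q, 1)) = sigma.arc (p + k * q + ?s) (p + k * q + k + ?s)"
      "rauzy (sigma_aut T4 a) (frag_of (pt p q, 2)) = sigma.arc (p + k * q + ?s) (p + k * q + 1 + ?s)" for p q
    using sigma.rauzy_tile[of 1 "pt p q"] sigma.rauzy_tile[of 2 "pt p q"] k by (simp_all add: tile_simps)
  have parts: "X_sigma_part T4 a 1 = sigma.arc ?s (k + ?s)"
    "X_sigma_part T4 a 2 = sigma.arc (k + ?s) (1 + (k + ?s))"
    "X_sigma_part' T4 a 1 = sigma.arc (1 + ?s) (1 + (k + ?s))"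
    "X_sigma_part' T4 a 2 = sigma.arc ?s (1 + ?s)"
    by (simp_all add: X_sigma_part_def X_sigma_part'_def eps_letter_def axis_pt zero_pt tile add_ac)
  have pieces: "piece T4 a 1 0 = sigma.arc ?s (k + ?s)"
    "piece T4 a 2 0 = sigma.arc (1 + (k + ?s)) (k + ?s)"
    "piece' T4 a 1 0 = sigma.arc (1 + ?s) (1 + (k + ?s))"
    "piece' T4 a 2 0 = sigma.arc (1 + ?s) ?s"
    by (simp_all add: piece_eq piece'_eq tile_simps endo_def abel_simps off algebra_simps)
  have "parts_claim T4 a 1"
  proof (rule parts_claim_single[where ?j0.0 = 1 and ?k0.0 = 0])
    fix j show "occ (delta_aut_inv T4 j) (eps_letter T4 1) = (if j = 1 then {0} else {})"
      using exhaust_2[of j] by (auto simp: occ_Cons occ_Nil endo_def eps_letter_def)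
  qed (use k in \<open>simp_all add: parts pieces sigma.is_interval_arc\<close>)
  moreover have "parts_claim T4 a 2"
  proof (rule parts_claim_single[where ?j0.0 = 2 and ?k0.0 = 0])
    fix j show "occ (delta_aut_inv T4 j) (eps_letter T4 2) = (if j = 2 then {0} else {})"
      using exhaust_2[of j] by (auto simp: occ_Cons occ_Nil endo_def eps_letter_def)
    show "X_sigma_part T4 a 2 = piece T4 a 2 0" "X_sigma_part' T4 a 2 = piece' T4 a 2 0"
      unfolding parts pieces by (rule sigma.arc_commute)+
  qed (use k in \<open>simp_all add: parts sigma.is_interval_arc\<close>)
  moreover have "X_sigma T4 a = sigma.arc ?s (1 + k + ?s)"
  proof -
    have "rauzy (sigma_aut T4 a) (frag_of (pt 0 0, 1) + frag_of (pt 0 1, 2))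
        = sigma.arc (sigma.iform (pt 0 0) + ?s) (sigma.iform (pt 1 1) + ?s)"
      by (rule sigma.rauzy_two_tiles)
        (use k in \<open>auto simp: ends_at_def bd_add bd_of tile_simps closed_segment_eq_real_ivl\<close>)
    then show ?thesis by (simp add: X_sigma_def eps_letter_def tile_simps)
  qed
  moreover have "X_sigma' T4 a = sigma.arc ?s (1 + k + ?s)"
  proof -
    have "rauzy (sigma_aut T4 a) (frag_of (pt 1 0, 1) + frag_of (pt 0 0, 2))
        = sigma.arc (sigma.iform (pt 0 0) + ?s) (sigma.iform (pt 1 1) + ?s)"
      by (rule sigma.rauzy_two_tiles)
        (use k in \<open>auto simp: ends_at_def bd_add bd_of tile_simps closed_segment_eq_real_ivl\<close>)
    then show ?thesis by (simp add: X_sigma'_def eps_letter_def tile_simps)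
  qed
  ultimately show ?thesis
    using k by (simp add: sigma.is_interval_arc)
qed

theorem theorem4:
  fixes t :: family and a :: int
  assumes "admissible t a"
  shows "(\<forall>i::2.
        X_sigma_part t a i = (\<Union>j. \<Union>k\<in>occ (delta_aut_inv t j) (eps_letter t i). piece t a j k)
      \<and> X_sigma_part' t a i = (\<Union>j. \<Union>k\<in>occ (delta_aut_inv t j) (eps_letter t i). piece' t a j k)
      \<and> (\<forall>j j' k k'. k \<in> occ (delta_aut_inv t j) (eps_letter t i) \<longrightarrow>
            k' \<in> occ (delta_aut_inv t j') (eps_letter t i) \<longrightarrow> (j, k) \<noteq> (j', k') \<longrightarrow>
            line_null (contracting_line (sigma_aut t a)) (piece t a j k \<inter> piece t a j' k')
          \<and> line_null (contracting_line (sigma_aut t a)) (piece' t a j k \<inter> piece' t a j' k'))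
      \<and> is_interval_in (contracting_line (sigma_aut t a)) (X_sigma_part t a i)
      \<and> is_interval_in (contracting_line (sigma_aut t a)) (X_sigma_part' t a i))
    \<and> is_interval_in (contracting_line (sigma_aut t a)) (X_sigma t a)
    \<and> is_interval_in (contracting_line (sigma_aut t a)) (X_sigma' t a)"
proof -
  have "parts_claim t a 1 \<and> parts_claim t a 2
    \<and> is_interval_in (contracting_line (sigma_aut t a)) (X_sigma t a)
    \<and> is_interval_in (contracting_line (sigma_aut t a)) (X_sigma' t a)"
    using assms conclusion_T1 conclusion_T2 conclusion_T4 by (cases t) simp_all
  then have "(\<forall>i. parts_claim t a i) \<and> is_interval_in (contracting_line (sigma_aut t a)) (X_sigma t a)
    \<and> is_interval_in (contracting_line (sigma_aut t a)) (X_sigma' t a)"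
    by (simp add: forall_2)
  then show ?thesis unfolding parts_claim_def .
qed

end
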